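(* Let $\mathcal{M}$ be any MDP in the two-step instance class defined in the context, with gap parameters $\Delta_1,\Delta_2>0$ and transition probability $p\in(0,1/2)$. Any learner executing the low-regret-to-PAC protocol (defined in the context, with a low-regret algorithm with constants $C_1,C_2,\alpha$) which computes an optimal policy with probability at least $1-\delta$ must collect at least $$K\ \ge\ \Omega\Big(\frac{\log(1/\delta)}{\Delta_1^2}+\frac{\log(1/\delta)}{p\,\Delta_2^2}\Big)$$ episodes, as long as $$\frac{\log(1/\delta)}{\Delta_2^2}\ \ge\ c\,\max\Big\{C_2,\ C_1^{\frac{1}{1-\alpha}}p^{\frac{-\alpha}{1-\alpha}}\Big\}$$ for a universal constant $c$. However, on this instance, $$\mathcal{C}^\star(\mathcal{M})\le\mathcal{O}\Big(\frac1{\Delta_1^2}+\frac1{\Delta_2^2}\Big),$$ and so, with probability $1-\delta$, the algorithm MOCA (run with confidence $\delta$ and a tolerance $\epsilon<\epsilon^\star$) will terminate in at most $K\le\widetilde{\mathcal{O}}(\mathcal{C}^\star(\mathcal{M})\cdot\log(1/\delta))$ episodes and return the optimal policy.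
   Context: **The instance class.** Horizon $H=2$, two actions $a_1,a_2$, and the episode always starts in state $s_0$; at step $2$ the state is $s_1$ or $s_2$. Transitions: $P(s_1|s_0,a_1)=1-p$, $P(s_2|s_0,a_1)=p$, $P(s_1|s_0,a_2)=0$, $P(s_2|s_0,a_2)=1$. Rewards: $R(s_0,a_1)\sim\mathrm{Bernoulli}(1)$, $R(s_0,a_2)\sim\mathrm{Bernoulli}(0)$, and for $i\in\{1,2\}$: $R(s_i,a_1)\sim\mathrm{Bernoulli}(0.5+\Delta_i)$, $R(s_i,a_2)\sim\mathrm{Bernoulli}(0.5)$. **Values.** $V_0^\pi$ is the expected total reward of policy $\pi$ in an episode, $V_0^\star=\sup_\pi V_0^\pi$; a policy is optimal if $V_0^\pi=V_0^\star$, and $\epsilon$-optimal if $V_0^\star-V_0^\pi\le\epsilon$. An algorithm is $(\epsilon,\delta)$-PAC if it returns an $\epsilon$-optimal policy with probability at least $1-\delta$. **Low-regret algorithm.** An algorithm is low-regret if its expected regret satisfies $\sum_{k=1}^K\mathbb{E}[V_0^\star-V_0^{\pi_k}]\le C_1K^\alpha+C_2$ for some constants $C_1,C_2$ and $\alpha\in(0,1)$, where $\pi_k$ is the policy it plays at episode $k$. **Low-regret-to-PAC protocol.** (1) The learner runs a low-regret algorithm for $K$ episodes and collects the resulting data. (2) Using this data any way it wishes, the learner proposes a (possibly stochastic) policy $\widehat\pi$. **Complexity.** $Q^\star_h,V_h^\star$ are the optimal action-value and value functions at step $h$, $\Delta_h(s,a)=V^\star_h(s)-Q^\star_h(s,a)$,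 $w_h^\pi(s,a)=\mathbb{P}_\pi[s_h=s,a_h=a]$, $W_h(s)=\sup_\pi\mathbb{P}_\pi[s_h=s]$. For an MDP with a unique optimal action at each $(s,h)$, $$\mathcal{C}^\star(\mathcal{M})=\sum_{h=1}^H\inf_\pi\max_{s,\,a:\,\Delta_h(s,a)>0}\frac1{w_h^\pi(s,a)\Delta_h(s,a)^2},$$ $\pi$ ranging over all deterministic and stochastic policies and, at each step $h$, $s$ ranging over the states that can occur at that step ($s_0$ at step 1; $s_1,s_2$ at step 2). With $\widetilde\Delta_h(s,a)=\Delta_h(s,a)$ if this is positive and $\widetilde\Delta_h(s,a)=\min_{a':\Delta_h(s,a')>0}\Delta_h(s,a')$ for the unique optimal action $a$, and $S$ the number of states, $$\epsilon^\star=\min\Big\{\min_{s,a,h}W_h(s)\widetilde\Delta_h(s,a)/3,\ 2H^2S\min_{s,h}W_h(s)\Big\},$$ the minima again over states that can occur at step $h$. **MOCA.** MOCA (Monte Carlo action elimination) is an $(\epsilon,\delta)$-PAC algorithm for finite-horizon tabular MDPs, taking as input a tolerance $\epsilon$ and a confidence $\delta$, with the following guarantee: if $\mathcal{M}$ has unique optimal actions and $\epsilon<\epsilon^\star$, then with probability at least $1-\delta$ it terminates after at most $\mathcal{C}^\star(\mathcal{M})\cdot H^2c\log\frac1\delta+C/\epsilon^\star$ episodes and returns the optimal policy, where $c=\mathrm{poly}\log(SAH/\epsilon^\star)$ and $C=\mathrm{poly}(S,A,H,\log\frac1{\epsilon^\star},\log\frac1\delta)$. **Notation.** $\Omega,\mathcal{O}$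 hide absolute constants; $\widetilde{\mathcal{O}}$ hides absolute constants and polylogarithmic terms.
   Formalization: The learner must be correct on all instances with the same p and gaps of either sign, at least Δ_i/2 in size (always proposing a_1 wins if all gaps are positive); δ ≤ δ_0 < 1/2 in the lower bound and δ ≤ δ_0 < 1 for MOCA, with constants, c included, depending on δ_0. *)

theory Defs
  imports "HOL-Probability.Probability"
begin

section \<open>Finite-horizon tabular MDPs\<close>

text \<open>Steps are numbered \<open>1, \<dots>, horizon\<close>. The next state drawn at the last step is
  never used.\<close>

record ('s, 'a) mdp =
  horizon :: nat
  initial :: 's
  trans :: "nat \<Rightarrow> 's \<Rightarrow> 'a \<Rightarrow> 's pmf"
  reward :: "nat \<Rightarrow> 's \<Rightarrow> 'a \<Rightarrow> real pmf"

definition valid_mdp :: "('s, 'a) mdp \<Rightarrow> bool" where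
  "valid_mdp M \<longleftrightarrow> horizon M \<ge> 1 \<and> (\<forall>h s a. set_pmf (reward M h s a) \<subseteq> {0..1})"

text \<open>Deterministic policies are those whose values have the form \<open>return_pmf a\<close>.\<close>

type_synonym ('s, 'a) policy = "nat \<Rightarrow> 's \<Rightarrow> 'a pmf"
type_synonym ('s, 'a) trajectory = "('s \<times> 'a \<times> real) list"

text \<open>\<open>rollout M \<pi> n h s\<close>: the \<open>n\<close> steps of \<open>\<pi>\<close> that start in state \<open>s\<close> at step \<open>h\<close>.\<close>

primrec rollout ::
  "('s, 'a) mdp \<Rightarrow> ('s, 'a) policy \<Rightarrow> nat \<Rightarrow> nat \<Rightarrow> 's \<Rightarrow> ('s, 'a) trajectory pmf" where
  "rollout M \<pi> 0 h s = return_pmf []"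
| "rollout M \<pi> (Suc n) h s =
     bind_pmf (\<pi> h s) (\<lambda>a.
     bind_pmf (reward M h s a) (\<lambda>r.
     bind_pmf (trans M h s a) (\<lambda>s'.
     map_pmf ((#) (s, a, r)) (rollout M \<pi> n (Suc h) s'))))"

definition episode :: "('s, 'a) mdp \<Rightarrow> ('s, 'a) policy \<Rightarrow> ('s, 'a) trajectory pmf" where
  "episode M \<pi> = rollout M \<pi> (horizon M) 1 (initial M)"

definition total_reward :: "('s, 'a) trajectory \<Rightarrow> real" where
  "total_reward \<tau> = (\<Sum>(s, a, r)\<leftarrow>\<tau>. r)"


section \<open>Values and optimality\<close>

definition V0 :: "('s, 'a) mdp \<Rightarrow> ('s, 'a) policy \<Rightarrow> real" where
  "V0 M \<pi> = measure_pmf.expectation (episode M \<pi>) total_reward"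

definition V0_star :: "('s, 'a) mdp \<Rightarrow> real" where
  "V0_star M = (SUP \<pi>. V0 M \<pi>)"

definition optimal :: "('s, 'a) mdp \<Rightarrow> ('s, 'a) policy \<Rightarrow> bool" where
  "optimal M \<pi> \<longleftrightarrow> V0 M \<pi> = V0_star M"

definition eps_optimal :: "('s, 'a) mdp \<Rightarrow> real \<Rightarrow> ('s, 'a) policy \<Rightarrow> bool" where
  "eps_optimal M \<epsilon> \<pi> \<longleftrightarrow> V0_star M - V0 M \<pi> \<le> \<epsilon>"

text \<open>Values from step \<open>h\<close> on, for \<open>1 \<le> h \<le> horizon M + 1\<close>.\<close>

definition V_pi :: "('s, 'a) mdp \<Rightarrow> ('s, 'a) policy \<Rightarrow> nat \<Rightarrow> 's \<Rightarrow> real" where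
  "V_pi M \<pi> h s =
     measure_pmf.expectation (rollout M \<pi> (Suc (horizon M) - h) h s) total_reward"

definition Q_pi :: "('s, 'a) mdp \<Rightarrow> ('s, 'a) policy \<Rightarrow> nat \<Rightarrow> 's \<Rightarrow> 'a \<Rightarrow> real" where
  "Q_pi M \<pi> h s a =
     measure_pmf.expectation (reward M h s a) (\<lambda>r. r)
     + measure_pmf.expectation (trans M h s a) (V_pi M \<pi> (Suc h))"

definition V_star :: "('s, 'a) mdp \<Rightarrow> nat \<Rightarrow> 's \<Rightarrow> real" where
  "V_star M h s = (SUP \<pi>. V_pi M \<pi> h s)"

definition Q_star :: "('s, 'a) mdp \<Rightarrow> nat \<Rightarrow> 's \<Rightarrow> 'a \<Rightarrow> real" where
  "Q_star M h s a = (SUP \<pi>. Q_pi M \<pi> h s a)"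

definition gap :: "('s, 'a) mdp \<Rightarrow> nat \<Rightarrow> 's \<Rightarrow> 'a \<Rightarrow> real" where
  "gap M h s a = V_star M h s - Q_star M h s a"

definition unique_optimal_actions :: "('s, 'a) mdp \<Rightarrow> bool" where
  "unique_optimal_actions M \<longleftrightarrow> (\<forall>h\<in>{1..horizon M}. \<forall>s. \<exists>!a. gap M h s a = 0)"


section \<open>Visitation probabilities and complexity\<close>

text \<open>Step \<open>h\<close> is the entry with index \<open>h - 1\<close> of a trajectory.\<close>

definition w_visit :: "('s, 'a) mdp \<Rightarrow> ('s, 'a) policy \<Rightarrow> nat \<Rightarrow> 's \<Rightarrow> 'a \<Rightarrow> real" where
  "w_visit M \<pi> h s a =
     measure_pmf.prob (episode M \<pi>) {\<tau>. fst (\<tau> ! (h - 1)) = s \<and> fst (snd (\<tau> ! (h - 1))) = a}"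

definition W_reach :: "('s, 'a) mdp \<Rightarrow> nat \<Rightarrow> 's \<Rightarrow> real" where
  "W_reach M h s = (SUP \<pi>. measure_pmf.prob (episode M \<pi>) {\<tau>. fst (\<tau> ! (h - 1)) = s})"

definition can_occur :: "('s, 'a) mdp \<Rightarrow> nat \<Rightarrow> 's \<Rightarrow> bool" where
  "can_occur M h s \<longleftrightarrow> 1 \<le> h \<and> h \<le> horizon M \<and> W_reach M h s > 0"

text \<open>Taken in \<^typ>\<open>ennreal\<close>, so that a policy that misses a relevant pair contributes
  \<open>1 / 0 = \<infinity>\<close>.\<close>

definition complexity :: "('s, 'a) mdp \<Rightarrow> ennreal" where
  "complexity M =
     (\<Sum>h = 1..horizon M. INF \<pi>. SUP (s, a)\<in>{(s, a). can_occur M h s \<and> gap M h s a > 0}.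
        1 / ennreal (w_visit M \<pi> h s a * (gap M h s a)\<^sup>2))"

definition gap_tilde :: "('s, 'a) mdp \<Rightarrow> nat \<Rightarrow> 's \<Rightarrow> 'a \<Rightarrow> real" where
  "gap_tilde M h s a =
     (if gap M h s a > 0 then gap M h s a else Min {gap M h s a' |a'. gap M h s a' > 0})"

definition eps_star :: "('s :: finite, 'a :: finite) mdp \<Rightarrow> real" where
  "eps_star M =
     min (Min {W_reach M h s * gap_tilde M h s a / 3 |h s a. can_occur M h s})
         (2 * real (horizon M)^2 * real CARD('s) * Min {W_reach M h s |h s. can_occur M h s})"


section \<open>Low-regret algorithms and the low-regret-to-PAC protocol\<close>

text \<open>The data consist of the policy played and the trajectory observed in each past episode.
  An algorithm may choose its next policy at random.\<close>

type_synonym ('s, 'a) data = "(('s, 'a) policy \<times> ('s, 'a) trajectory) list"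
type_synonym ('s, 'a) algorithm = "('s, 'a) data \<Rightarrow> ('s, 'a) policy pmf"

primrec collect :: "('s, 'a) mdp \<Rightarrow> ('s, 'a) algorithm \<Rightarrow> nat \<Rightarrow> ('s, 'a) data pmf" where
  "collect M alg 0 = return_pmf []"
| "collect M alg (Suc k) =
     bind_pmf (collect M alg k) (\<lambda>d.
     bind_pmf (alg d) (\<lambda>\<pi>.
     map_pmf (\<lambda>\<tau>. d @ [(\<pi>, \<tau>)]) (episode M \<pi>)))"

definition expected_regret :: "('s, 'a) mdp \<Rightarrow> ('s, 'a) algorithm \<Rightarrow> nat \<Rightarrow> real" where
  "expected_regret M alg K =
     (\<Sum>k<K. measure_pmf.expectation (collect M alg K) (\<lambda>d. V0_star M - V0 M (fst (d ! k))))"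

definition low_regret ::
  "('s, 'a) mdp \<Rightarrow> ('s, 'a) algorithm \<Rightarrow> nat \<Rightarrow> real \<Rightarrow> real \<Rightarrow> real \<Rightarrow> bool" where
  "low_regret M alg K C1 C2 \<alpha> \<longleftrightarrow> expected_regret M alg K \<le> C1 * real K powr \<alpha> + C2"

text \<open>The proposal rule \<open>propose\<close> maps the collected data to a policy, possibly at random.\<close>

definition low_regret_to_pac ::
  "('s, 'a) mdp \<Rightarrow> ('s, 'a) algorithm \<Rightarrow> nat \<Rightarrow> (('s, 'a) data \<Rightarrow> ('s, 'a) policy pmf)
     \<Rightarrow> ('s, 'a) policy pmf" where
  "low_regret_to_pac M alg K propose = bind_pmf (collect M alg K) propose"

definition computes_optimal ::
  "('s, 'a) mdp \<Rightarrow> ('s, 'a) algorithm \<Rightarrow> nat \<Rightarrow> (('s, 'a) data \<Rightarrow> ('s, 'a) policy pmf)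
     \<Rightarrow> real \<Rightarrow> bool" where
  "computes_optimal M alg K propose \<delta> \<longleftrightarrow>
     measure_pmf.prob (low_regret_to_pac M alg K propose) {\<pi>. optimal M \<pi>} \<ge> 1 - \<delta>"


section \<open>PAC algorithms and MOCA\<close>

datatype ('s, 'a) decision = Play "('s, 'a) policy" | Return "('s, 'a) policy"

type_synonym ('s, 'a) pac_algorithm = "('s, 'a) data \<Rightarrow> ('s, 'a) decision pmf"

text \<open>\<open>result M alg n d\<close> is the policy returned after at most \<open>n\<close> episodes beyond the data \<open>d\<close>,
  or \<open>None\<close> if the algorithm has not terminated by then.\<close>

primrec result ::
  "('s, 'a) mdp \<Rightarrow> ('s, 'a) pac_algorithm \<Rightarrow> nat \<Rightarrow> ('s, 'a) data \<Rightarrow> ('s, 'a) policy option pmf"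
where
  "result M alg 0 d =
     map_pmf (\<lambda>x. case x of Play \<pi> \<Rightarrow> None | Return \<pi> \<Rightarrow> Some \<pi>) (alg d)"
| "result M alg (Suc n) d =
     bind_pmf (alg d) (\<lambda>x. case x of
         Play \<pi> \<Rightarrow> bind_pmf (episode M \<pi>) (\<lambda>\<tau>. result M alg n (d @ [(\<pi>, \<tau>)]))
       | Return \<pi> \<Rightarrow> return_pmf (Some \<pi>))"

definition returns_within ::
  "('s, 'a) mdp \<Rightarrow> ('s, 'a) pac_algorithm \<Rightarrow> nat \<Rightarrow> (('s, 'a) policy \<Rightarrow> bool) \<Rightarrow> real" where
  "returns_within M alg n P = measure_pmf.prob (result M alg n []) {Some \<pi> |\<pi>. P \<pi>}"

definition pac_on :: "('s, 'a) mdp \<Rightarrow> ('s, 'a) pac_algorithm \<Rightarrow> real \<Rightarrow> real \<Rightarrow> bool" where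
  "pac_on M alg \<epsilon> \<delta> \<longleftrightarrow> (SUP n. returns_within M alg n (eps_optimal M \<epsilon>)) \<ge> 1 - \<delta>"

text \<open>The arguments of \<open>moca\<close> are the horizon, the tolerance and the confidence; the numbers of
  states and actions are given by the types. A polynomial in several quantities is
  bounded, up to constants, by a power of one plus their sum, which gives the two factors below.\<close>

definition is_moca ::
  "(nat \<Rightarrow> real \<Rightarrow> real \<Rightarrow> ('s :: finite, 'a :: finite) pac_algorithm) \<Rightarrow> bool" where
  "is_moca moca \<longleftrightarrow>
     (\<forall>M \<epsilon> \<delta>. valid_mdp M \<and> 0 < \<epsilon> \<and> 0 < \<delta> \<and> \<delta> < 1 \<longrightarrow>
        pac_on M (moca (horizon M) \<epsilon> \<delta>) \<epsilon> \<delta>) \<and>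
     (\<exists>a b. \<forall>M \<epsilon> \<delta>.
        valid_mdp M \<and> unique_optimal_actions M \<and> 0 < \<epsilon> \<and> \<epsilon> < eps_star M \<and> 0 < \<delta> \<and> \<delta> < 1 \<longrightarrow>
        (let H = real (horizon M); S = real CARD('s); A = real CARD('a);
             c = a * (1 + ln (S * A * H / eps_star M)) ^ b;
             C = a * (1 + S + A + H + \<bar>ln (1 / eps_star M)\<bar> + ln (1 / \<delta>)) ^ b
         in \<exists>K. ennreal (real K) \<le> complexity M * ennreal (H\<^sup>2 * c * ln (1 / \<delta>))
                                    + ennreal (C / eps_star M) \<and>
                returns_within M (moca (horizon M) \<epsilon> \<delta>) K (optimal M) \<ge> 1 - \<delta>))"


section \<open>The instance class\<close>

datatype state = S0 | S1 | S2
datatype action = A1 | A2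

instance state :: finite
proof
  have "(UNIV :: state set) = {S0, S1, S2}"
    using state.exhaust by auto
  then show "finite (UNIV :: state set)"
    by (metis finite.emptyI finite_insert)
qed

instance action :: finite
proof
  have "(UNIV :: action set) = {A1, A2}"
    using action.exhaust by auto
  then show "finite (UNIV :: action set)"
    by (metis finite.emptyI finite_insert)
qed

definition bernoulli_reward :: "real \<Rightarrow> real pmf" where
  "bernoulli_reward q = map_pmf of_bool (bernoulli_pmf q)"

text \<open>Only the transitions out of \<open>S0\<close> at step 1 matter; the other states are made absorbing.
  \<open>bernoulli_pmf\<close> truncates its parameter to the unit interval, so the gap parameters
  have to lie in \<open>[-1/2, 1/2]\<close>; a negative one makes \<open>A2\<close> the better action.\<close>

definition two_step :: "real \<Rightarrow> real \<Rightarrow> real \<Rightarrow> (state, action) mdp" where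
  "two_step \<Delta>1 \<Delta>2 p =
     \<lparr>horizon = 2,
      initial = S0,
      trans = (\<lambda>h s a. case s of
          S0 \<Rightarrow> (case a of A1 \<Rightarrow> map_pmf (\<lambda>b. if b then S2 else S1) (bernoulli_pmf p)
                         | A2 \<Rightarrow> return_pmf S2)
        | S1 \<Rightarrow> return_pmf S1
        | S2 \<Rightarrow> return_pmf S2),
      reward = (\<lambda>h s a. case s of
          S0 \<Rightarrow> (case a of A1 \<Rightarrow> bernoulli_reward 1 | A2 \<Rightarrow> bernoulli_reward 0)
        | S1 \<Rightarrow> (case a of A1 \<Rightarrow> bernoulli_reward (1 / 2 + \<Delta>1) | A2 \<Rightarrow> bernoulli_reward (1 / 2))
        | S2 \<Rightarrow> (case a of A1 \<Rightarrow> bernoulli_reward (1 / 2 + \<Delta>2) | A2 \<Rightarrow> bernoulli_reward (1 / 2)))\<rparr>"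

text \<open>The learner has to be correct on a family of instances, since on a single one it could
  propose the optimal policy without any data. As its number of episodes is fixed in advance, it
  cannot be correct for arbitrarily small gaps either. The instances required here share \<open>p\<close> and
  have gap parameters of either sign that are at least half as large. The factor \<open>1/2\<close> keeps the
  relative entropies between instances finite when \<open>\<Delta>1\<close> or \<open>\<Delta>2\<close> equals \<open>1/2\<close>.\<close>

definition computes_optimal_near ::
  "real \<Rightarrow> real \<Rightarrow> real \<Rightarrow> (state, action) algorithm \<Rightarrow> nat
     \<Rightarrow> ((state, action) data \<Rightarrow> (state, action) policy pmf) \<Rightarrow> real \<Rightarrow> bool" where
  "computes_optimal_near \<Delta>1 \<Delta>2 p alg K propose \<delta> \<longleftrightarrow>
     (\<forall>\<Delta>1' \<Delta>2'. \<Delta>1 / 2 \<le> \<bar>\<Delta>1'\<bar> \<and> \<bar>\<Delta>1'\<bar> \<le> 1 / 2 \<and> \<Delta>2 / 2 \<le> \<bar>\<Delta>2'\<bar> \<and> \<bar>\<Delta>2'\<bar> \<le> 1 / 2 \<longrightarrow>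
        computes_optimal (two_step \<Delta>1' \<Delta>2' p) alg K propose \<delta>)"

end

theory Submission
  imports Defs
begin

text \<open>Playing \<open>A2\<close> in \<open>S0\<close> costs regret at least \<open>1/2\<close>, so a low-regret learner sees \<open>S2\<close> at most
  \<open>p K + 2 (C1 K powr \<alpha> + C2)\<close> times in expectation. Replacing \<open>\<Delta>i\<close> by \<open>- \<Delta>i / 2\<close> changes the optimal
  policy, while each visit to \<open>Si\<close> contributes at most \<open>12 \<Delta>i\<^sup>2\<close> to the relative entropy between
  the two data distributions. Being correct on both instances requires relative entropy of order
  \<open>ln (1 / \<delta>)\<close>, which gives both terms of the lower bound; the assumption on \<open>C1\<close> and \<open>C2\<close> says
  that the regret term is too small to pay for the visits to \<open>S2\<close>, so \<open>p K\<close> has to.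

  For the complexity, a policy that mixes both actions in \<open>S0\<close> reaches \<open>S1\<close> and \<open>S2\<close> with
  constant probability. Conversely, visitation probabilities are at most 1, so the complexity is
  at least \<open>1 / (min \<Delta>1 \<Delta>2)\<^sup>2\<close>, which absorbs the term \<open>C / \<epsilon>\<^sup>\<star>\<close> in the guarantee for MOCA because
  \<open>\<epsilon>\<^sup>\<star> \<ge> min \<Delta>1 \<Delta>2 / 6\<close>.\<close>

section \<open>Expectations of bounded functions\<close>

lemma integrable_pmf_bounded:
  fixes f :: "'a \<Rightarrow> real"
  assumes "\<And>x. x \<in> set_pmf P \<Longrightarrow> \<bar>f x\<bar> \<le> B"
  shows "integrable (measure_pmf P) f"
  using assms by (intro measure_pmf.integrable_const_bound[where B = B]) (auto simp: AE_measure_pmf_iff)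

text \<open>The bound \<open>l\<close> secures integrability: the Bochner integral of a
  non-integrable function is 0, which may exceed \<open>u\<close>.\<close>

lemma expectation_le_const:
  fixes f :: "'a \<Rightarrow> real"
  assumes "\<And>x. x \<in> set_pmf P \<Longrightarrow> l \<le> f x" and "\<And>x. x \<in> set_pmf P \<Longrightarrow> f x \<le> u"
  shows "measure_pmf.expectation P f \<le> u"
proof (rule measure_pmf.integral_le_const)
  show "integrable (measure_pmf P) f"
    using assms by (intro integrable_pmf_bounded[where B = "max \<bar>l\<bar> \<bar>u\<bar>"]) force
qed (use assms in \<open>auto simp: AE_measure_pmf_iff\<close>)

lemma expectation_ge_const:
  fixes f :: "'a \<Rightarrow> real"
  assumes "\<And>x. x \<in> set_pmf P \<Longrightarrow> l \<le> f x" and "\<And>x. x \<in> set_pmf P \<Longrightarrow> f x \<le> u"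
  shows "l \<le> measure_pmf.expectation P f"
proof (rule measure_pmf.integral_ge_const)
  show "integrable (measure_pmf P) f"
    using assms by (intro integrable_pmf_bounded[where B = "max \<bar>l\<bar> \<bar>u\<bar>"]) force
qed (use assms in \<open>auto simp: AE_measure_pmf_iff\<close>)

lemma expectation_abs_le:
  fixes f :: "'a \<Rightarrow> real"
  assumes "\<And>x. x \<in> set_pmf P \<Longrightarrow> \<bar>f x\<bar> \<le> B"
  shows "\<bar>measure_pmf.expectation P f\<bar> \<le> B"
  using expectation_le_const[of P "- B" f B] expectation_ge_const[of P "- B" f B] assms
  by (fastforce simp: abs_le_iff)

lemma expectation_mono:
  fixes f g :: "'a \<Rightarrow> real"
  assumes "\<And>x. x \<in> set_pmf P \<Longrightarrow> f x \<le> g x"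
    and "\<And>x. x \<in> set_pmf P \<Longrightarrow> \<bar>f x\<bar> \<le> B" and "\<And>x. x \<in> set_pmf P \<Longrightarrow> \<bar>g x\<bar> \<le> C"
  shows "measure_pmf.expectation P f \<le> measure_pmf.expectation P g"
  using assms by (intro integral_mono_AE integrable_pmf_bounded) (auto simp: AE_measure_pmf_iff)

text \<open>The tower rule for nonnegative integrals, applied to the nonnegative function
  \<open>f + B\<close> and carried back to real expectations.\<close>

lemma expectation_bind:
  fixes f :: "'b \<Rightarrow> real"
  assumes B: "\<And>y. y \<in> set_pmf (bind_pmf P Q) \<Longrightarrow> \<bar>f y\<bar> \<le> B"
  shows "measure_pmf.expectation (bind_pmf P Q) f
       = measure_pmf.expectation P (\<lambda>x. measure_pmf.expectation (Q x) f)"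
proof -
  define E where "E x = measure_pmf.expectation (Q x) f" for x
  have BQ: "\<bar>f y\<bar> \<le> B" if "x \<in> set_pmf P" "y \<in> set_pmf (Q x)" for x y
    using that B by auto
  have E: "\<bar>E x\<bar> \<le> B" if "x \<in> set_pmf P" for x
    unfolding E_def using BQ that by (intro expectation_abs_le) auto
  have shift: "(\<integral>\<^sup>+y. ennreal (h y + B) \<partial>R) = ennreal (measure_pmf.expectation R h + B)"
    if "\<And>y. y \<in> set_pmf R \<Longrightarrow> \<bar>h y\<bar> \<le> B" for R :: "'c pmf" and h :: "'c \<Rightarrow> real"
  proof -
    have [simp]: "integrable (measure_pmf R) h"
      using that by (rule integrable_pmf_bounded)
    have "(\<integral>\<^sup>+y. ennreal (h y + B) \<partial>R) = ennreal (measure_pmf.expectation R (\<lambda>y. h y + B))"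
      using that by (intro nn_integral_eq_integral) (fastforce simp: AE_measure_pmf_iff abs_le_iff)+
    then show ?thesis by simp
  qed
  have "ennreal (measure_pmf.expectation (bind_pmf P Q) f + B)
      = (\<integral>\<^sup>+y. ennreal (f y + B) \<partial>bind_pmf P Q)"
    by (rule shift[symmetric]) (rule B)
  also have "\<dots> = (\<integral>\<^sup>+x. (\<integral>\<^sup>+y. ennreal (f y + B) \<partial>Q x) \<partial>P)"
    by simp
  also have "\<dots> = (\<integral>\<^sup>+x. ennreal (E x + B) \<partial>P)"
    unfolding E_def using BQ by (intro nn_integral_cong_AE) (auto simp: AE_measure_pmf_iff intro!: shift)
  also have "\<dots> = ennreal (measure_pmf.expectation P E + B)"
    using E by (rule shift)
  finally have "ennreal (measure_pmf.expectation (bind_pmf P Q) f + B) = ennreal (measure_pmf.expectation P E + B)" .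
  \<comment> \<open>\<open>ennreal\<close> is injective only on nonnegative reals, so both sides
    need a sign before it can be cancelled.\<close>
  moreover have "0 \<le> measure_pmf.expectation (bind_pmf P Q) f + B"
    using expectation_abs_le[of "bind_pmf P Q" f B] B by (simp add: abs_le_iff)
  moreover have "0 \<le> measure_pmf.expectation P E + B"
    using expectation_abs_le[of P E B] E by (simp add: abs_le_iff)
  ultimately have "measure_pmf.expectation (bind_pmf P Q) f + B = measure_pmf.expectation P E + B"
    by simp
  then show ?thesis
    by (simp add: E_def[abs_def])
qed

section \<open>Relative entropy\<close>

text \<open>\<open>KL_le P Q k\<close> says that the relative entropy of \<open>P\<close> with respect to \<open>Q\<close> is at most \<open>k\<close>, in the
  Donsker--Varadhan form. This needs no densities, and the chain rule becomes a one-line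
  substitution of \<open>ln (E (exp g))\<close> for the test function \<open>g\<close>.\<close>

definition KL_le :: "'a pmf \<Rightarrow> 'a pmf \<Rightarrow> real \<Rightarrow> bool" where
  "KL_le P Q k \<longleftrightarrow> (\<forall>g B. (\<forall>x. \<bar>g x\<bar> \<le> B) \<longrightarrow>
     measure_pmf.expectation P g - ln (measure_pmf.expectation Q (\<lambda>x. exp (g x))) \<le> k)"

lemma KL_leD:
  assumes "KL_le P Q k" "\<And>x. \<bar>g x\<bar> \<le> B"
  shows "measure_pmf.expectation P g \<le> ln (measure_pmf.expectation Q (\<lambda>x. exp (g x))) + k"
proof -
  have "measure_pmf.expectation P g - ln (measure_pmf.expectation Q (\<lambda>x. exp (g x))) \<le> k"
    using assms unfolding KL_le_def by blast
  then show ?thesis by simp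
qed

lemma KL_le_mono: "KL_le P Q k \<Longrightarrow> k \<le> k' \<Longrightarrow> KL_le P Q k'"
  unfolding KL_le_def by (meson order_trans)

lemma expectation_exp_bounds:
  fixes g :: "'a \<Rightarrow> real"
  assumes "\<And>x. \<bar>g x\<bar> \<le> B"
  shows "exp (- B) \<le> measure_pmf.expectation P (\<lambda>x. exp (g x))"
    and "measure_pmf.expectation P (\<lambda>x. exp (g x)) \<le> exp B"
  using assms by (auto intro!: expectation_ge_const[where u = "exp B"]
      expectation_le_const[where l = "exp (- B)"] simp: abs_le_iff minus_le_iff)

lemma expectation_exp_pos:
  fixes g :: "'a \<Rightarrow> real"
  assumes "\<And>x. \<bar>g x\<bar> \<le> B"
  shows "0 < measure_pmf.expectation P (\<lambda>x. exp (g x))"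
  by (rule less_le_trans[OF exp_gt_zero expectation_exp_bounds(1)]) (rule assms)

text \<open>Log-moments of a bounded test function are again bounded, hence again admissible as a
  test function in the chain rule.\<close>

lemma abs_ln_expectation_exp_le:
  fixes g :: "'a \<Rightarrow> real"
  assumes "\<And>x. \<bar>g x\<bar> \<le> B"
  shows "\<bar>ln (measure_pmf.expectation P (\<lambda>x. exp (g x)))\<bar> \<le> B"
proof -
  have pos: "0 < measure_pmf.expectation P (\<lambda>x. exp (g x))"
    by (rule expectation_exp_pos) (rule assms)
  have "ln (exp (- B)) \<le> ln (measure_pmf.expectation P (\<lambda>x. exp (g x)))"
    by (intro ln_mono expectation_exp_bounds(1) assms pos exp_gt_zero)
  moreover have "ln (measure_pmf.expectation P (\<lambda>x. exp (g x))) \<le> ln (exp B)"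
    by (intro ln_mono expectation_exp_bounds(2) assms pos exp_gt_zero)
  ultimately show ?thesis by simp
qed

text \<open>Jensen's inequality for the logarithm: integrate \<open>ln y \<le> y - 1\<close> at
  \<open>y = exp (g x) / T\<close>, whose mean is 1.\<close>

lemma KL_le_refl: "KL_le P P 0"
  unfolding KL_le_def
proof (intro allI impI)
  fix g :: "'a \<Rightarrow> real" and B assume B: "\<forall>x. \<bar>g x\<bar> \<le> B"
  define T where "T = measure_pmf.expectation P (\<lambda>x. exp (g x))"
  have T: "0 < T"
    unfolding T_def using B by (intro expectation_exp_pos) auto
  have int: "integrable (measure_pmf P) g" "integrable (measure_pmf P) (\<lambda>x. exp (g x))"
    using B by (auto intro: integrable_pmf_bounded[where B = B]
        intro!: integrable_pmf_bounded[of _ "\<lambda>x. exp (g x)" "exp B"] simp: abs_le_iff)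
  have "g x - ln T \<le> exp (g x) / T - 1" for x
    using ln_le_minus_one[of "exp (g x) / T"] T by (simp add: ln_div)
  then have "measure_pmf.expectation P (\<lambda>x. g x - ln T) \<le> measure_pmf.expectation P (\<lambda>x. exp (g x) / T - 1)"
    using int by (intro integral_mono) auto
  also have "\<dots> = 0"
    using int T by (simp add: T_def)
  finally show "measure_pmf.expectation P g - ln (measure_pmf.expectation P (\<lambda>x. exp (g x))) \<le> 0"
    using int by (simp add: T_def)
qed

text \<open>The conditional cost \<open>c\<close> is averaged under the first law \<open>P\<close>;
  this is why the lower bound later counts visits on the true instance and not on the
  alternatives.\<close>

lemma KL_le_bind:
  assumes P: "KL_le P P' k" and Q: "\<And>x. x \<in> set_pmf P \<Longrightarrow> KL_le (Q x) (Q' x) (c x)"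
    and c: "\<And>x. x \<in> set_pmf P \<Longrightarrow> \<bar>c x\<bar> \<le> C"
  shows "KL_le (bind_pmf P Q) (bind_pmf P' Q') (k + measure_pmf.expectation P c)"
  unfolding KL_le_def
proof (intro allI impI)
  fix g :: "'b \<Rightarrow> real" and B assume B: "\<forall>x. \<bar>g x\<bar> \<le> B"
  define G where "G x = ln (measure_pmf.expectation (Q' x) (\<lambda>y. exp (g y)))" for x
  have GB: "\<bar>G x\<bar> \<le> B" for x
    unfolding G_def using B by (intro abs_ln_expectation_exp_le) auto
  have "measure_pmf.expectation (bind_pmf P Q) g
      = measure_pmf.expectation P (\<lambda>x. measure_pmf.expectation (Q x) g)"
    using B by (intro expectation_bind) auto
  also have "\<dots> \<le> measure_pmf.expectation P (\<lambda>x. G x + c x)"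
  proof (rule expectation_mono)
    fix x assume x: "x \<in> set_pmf P"
    show "measure_pmf.expectation (Q x) g \<le> G x + c x"
      unfolding G_def using Q[OF x] B by (intro KL_leD) auto
    show "\<bar>measure_pmf.expectation (Q x) g\<bar> \<le> B"
      using B by (intro expectation_abs_le) auto
    show "\<bar>G x + c x\<bar> \<le> B + C"
      using GB[of x] c[OF x] by linarith
  qed
  also have "\<dots> = measure_pmf.expectation P G + measure_pmf.expectation P c"
    using GB c by (intro Bochner_Integration.integral_add integrable_pmf_bounded)
  also have "measure_pmf.expectation P G \<le> ln (measure_pmf.expectation P' (\<lambda>x. exp (G x))) + k"
    using P GB by (rule KL_leD)
  \<comment> \<open>\<open>exp (G x)\<close> is the inner exponential moment, so the tower rule
    merges the two stages.\<close>
  also have "measure_pmf.expectation P' (\<lambda>x. exp (G x)) = measure_pmf.expectation (bind_pmf P' Q') (\<lambda>y. exp (g y))"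
    unfolding G_def using B
    by (subst expectation_bind[where B = "exp B"])
       (auto simp: abs_le_iff intro!: Bochner_Integration.integral_cong exp_ln expectation_exp_pos[of g B])
  finally show "measure_pmf.expectation (bind_pmf P Q) g
      - ln (measure_pmf.expectation (bind_pmf P' Q') (\<lambda>y. exp (g y))) \<le> k + measure_pmf.expectation P c"
    by simp
qed

lemma KL_le_map:
  assumes "KL_le P P' k"
  shows "KL_le (map_pmf f P) (map_pmf f P') k"
  unfolding KL_le_def integral_map_pmf
proof (intro allI impI)
  fix g :: "'b \<Rightarrow> real" and B assume "\<forall>x. \<bar>g x\<bar> \<le> B"
  then show "measure_pmf.expectation P (\<lambda>x. g (f x))
      - ln (measure_pmf.expectation P' (\<lambda>x. exp (g (f x)))) \<le> k"
    using KL_leD[OF assms, of "\<lambda>x. g (f x)" B] by simp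
qed

lemma KL_le_bind_same:
  assumes "\<And>x. x \<in> set_pmf P \<Longrightarrow> KL_le (Q x) (Q' x) (c x)"
    and "\<And>x. x \<in> set_pmf P \<Longrightarrow> \<bar>c x\<bar> \<le> C"
  shows "KL_le (bind_pmf P Q) (bind_pmf P Q') (measure_pmf.expectation P c)"
  using KL_le_bind[OF KL_le_refl assms] by simp

lemma KL_le_bind_same_const:
  assumes "\<And>x. x \<in> set_pmf P \<Longrightarrow> KL_le (Q x) (Q' x) k"
  shows "KL_le (bind_pmf P Q) (bind_pmf P Q') k"
  using KL_le_bind_same[of P Q Q' "\<lambda>_. k" "\<bar>k\<bar>"] assms by simp

text \<open>The right-hand side is the chi-square divergence, which dominates relative entropy. It
  stays finite for \<open>q\<close> equal to 0 or 1 as long as \<open>q'\<close> is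
  interior.\<close>

lemma KL_le_bernoulli:
  assumes q: "0 \<le> q" "q \<le> 1" and q': "0 < q'" "q' < 1"
  shows "KL_le (bernoulli_pmf q) (bernoulli_pmf q') ((q - q')\<^sup>2 / (q' * (1 - q')))"
  unfolding KL_le_def
proof (intro allI impI)
  fix g :: "bool \<Rightarrow> real" and B
  define T where "T = exp (g True) * q' + exp (g False) * (1 - q')"
  have T: "0 < T"
    unfolding T_def using q' by (intro add_pos_pos mult_pos_pos) auto
  \<comment> \<open>Contribution of one outcome with probabilities \<open>r\<close> and
    \<open>r'\<close>. Over both outcomes the terms \<open>exp a / T * r' - r\<close> sum to 0, and
    the remaining ones to the chi-square divergence.\<close>
  have key: "r * (a - ln T) \<le> exp a / T * r' - r + (r\<^sup>2 / r' - r)" if "0 \<le> r" "0 < r'" for r r' a :: real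
  proof (cases "r = 0")
    case True
    then show ?thesis using T that by simp
  next
    case False
    with that have r: "0 < r" by simp
    have "a - ln T = ln (exp a / T * (r' / r)) + ln (r / r')"
      using r that T by (simp add: ln_mult ln_div)
    also have "\<dots> \<le> (exp a / T * (r' / r) - 1) + (r / r' - 1)"
      using r that T by (intro add_mono ln_le_minus_one) auto
    finally have "r * (a - ln T) \<le> r * ((exp a / T * (r' / r) - 1) + (r / r' - 1))"
      using r by (intro mult_left_mono) auto
    also have "\<dots> = exp a / T * r' - r + (r\<^sup>2 / r' - r)"
      using r that by (simp add: field_simps power2_eq_square)
    finally show ?thesis .
  qed
  have "exp (g True) / T * q' + exp (g False) / T * (1 - q') = T / T"
    unfolding times_divide_eq_left add_divide_distrib[symmetric] by (simp add: T_def)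
  then have one: "exp (g True) / T * q' + exp (g False) / T * (1 - q') = 1"
    using T by simp
  have chi: "q\<^sup>2 / q' + (1 - q)\<^sup>2 / (1 - q') - 1 = (q - q')\<^sup>2 / (q' * (1 - q'))"
    using q' by (simp add: field_simps power2_eq_square)
  have "q * (g True - ln T) + (1 - q) * (g False - ln T) \<le> q\<^sup>2 / q' + (1 - q)\<^sup>2 / (1 - q') - 1"
    using key[of q q' "g True"] key[of "1 - q" "1 - q'" "g False"] q q' one by simp
  then show "measure_pmf.expectation (bernoulli_pmf q) g
      - ln (measure_pmf.expectation (bernoulli_pmf q') (\<lambda>x. exp (g x))) \<le> (q - q')\<^sup>2 / (q' * (1 - q'))"
    using q q' unfolding chi by (simp add: T_def algebra_simps)
qed

text \<open>The test function \<open>2 ln ((1 - \<delta>) / \<delta>)\<close> on \<open>A\<close> is, up to a constant, the log-likelihood ratio of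
  Bernoulli distributions with parameters \<open>1 - \<delta>\<close> and \<open>\<delta>\<close>.\<close>

lemma KL_le_event:
  assumes KL: "KL_le P Q k" and P: "1 - \<delta> \<le> measure_pmf.prob P A" and Q: "measure_pmf.prob Q A \<le> \<delta>"
    and \<delta>: "0 < \<delta>" "\<delta> \<le> 1 / 2"
  shows "(1 - 2 * \<delta>) * ln ((1 - \<delta>) / \<delta>) \<le> k"
proof -
  define r where "r = (1 - \<delta>) / \<delta>"
  have r: "1 \<le> r" using \<delta> by (simp add: r_def field_simps)
  define g :: "'a \<Rightarrow> real" where "g x = 2 * ln r * indicator A x" for x
  have "2 * ln r * (1 - \<delta>) \<le> 2 * ln r * measure_pmf.prob P A"
    using P r by (intro mult_left_mono) auto
  also have "\<dots> = measure_pmf.expectation P g"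
    by (simp add: g_def[abs_def])
  also have "\<dots> \<le> ln (measure_pmf.expectation Q (\<lambda>x. exp (g x))) + k"
    using KL r by (intro KL_leD[where B = "2 * ln r"]) (auto simp: g_def indicator_def)
  also have "(\<lambda>x. exp (g x)) = (\<lambda>x. 1 + (r\<^sup>2 - 1) * indicator A x)"
    using r by (auto simp: g_def fun_eq_iff indicator_def exp_double)
  also have "measure_pmf.expectation Q \<dots> = 1 + (r\<^sup>2 - 1) * measure_pmf.prob Q A"
    by (simp add: integrable_pmf_bounded[where B = 1] indicator_le_1)
  also have "ln (1 + (r\<^sup>2 - 1) * measure_pmf.prob Q A) \<le> ln (1 + (r\<^sup>2 - 1) * \<delta>)"
  proof -
    have "0 \<le> (r\<^sup>2 - 1) * measure_pmf.prob Q A" using r by simp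
    moreover have "(r\<^sup>2 - 1) * measure_pmf.prob Q A \<le> (r\<^sup>2 - 1) * \<delta>"
      using r Q by (intro mult_left_mono) auto
    ultimately show ?thesis by (subst ln_le_cancel_iff) linarith+
  qed
  \<comment> \<open>With this \<open>r\<close> the moment bound collapses, leaving
    \<open>2 * (1 - \<delta>) * ln r - ln r = (1 - 2 * \<delta>) * ln r\<close>.\<close>
  also have "1 + (r\<^sup>2 - 1) * \<delta> = r"
    using \<delta> by (simp add: r_def field_simps power2_eq_square)
  finally show ?thesis
    by (simp add: r_def[symmetric] algebra_simps)
qed

section \<open>Values of the two-step instances\<close>

text \<open>Step 1 has to stay \<open>1\<close>, or lemmas about it no longer match after simplification.\<close>

declare One_nat_def [simp del]

section \<open>The Bellman recursion for a fixed policy\<close>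

lemma reward_bounds:
  assumes "valid_mdp M" "r \<in> set_pmf (reward M h s a)"
  shows "0 \<le> r \<and> r \<le> 1"
  using assms unfolding valid_mdp_def by (meson atLeastAtMost_iff subsetD)

lemma rollout_total_reward_bounds:
  assumes "valid_mdp M" "\<tau> \<in> set_pmf (rollout M \<pi> n h s)"
  shows "0 \<le> total_reward \<tau> \<and> total_reward \<tau> \<le> real n"
  using assms(2)
proof (induction n arbitrary: h s \<tau>)
  case 0
  then show ?case by (simp add: total_reward_def)
next
  case (Suc n)
  then obtain a r s' \<tau>' where r: "r \<in> set_pmf (reward M h s a)"
    and \<tau>': "\<tau>' \<in> set_pmf (rollout M \<pi> n (Suc h) s')" and \<tau>: "\<tau> = (s, a, r) # \<tau>'"
    by auto
  have "0 \<le> r \<and> r \<le> 1"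
    using assms(1) r by (rule reward_bounds)
  then show ?case
    using Suc.IH[OF \<tau>'] by (simp add: \<tau> total_reward_def)
qed

text \<open>The tower rule is applied to action, reward and next state in turn; each layer gets its
  own bound on the total reward to guarantee integrability.\<close>

lemma expectation_rollout_Suc:
  assumes M: "valid_mdp M"
  shows "measure_pmf.expectation (rollout M \<pi> (Suc n) h s) total_reward =
    measure_pmf.expectation (\<pi> h s) (\<lambda>a. measure_pmf.expectation (reward M h s a) (\<lambda>r. r)
      + measure_pmf.expectation (trans M h s a)
          (\<lambda>s'. measure_pmf.expectation (rollout M \<pi> n (Suc h) s') total_reward))"
proof -
  define E where "E s' = measure_pmf.expectation (rollout M \<pi> n (Suc h) s') total_reward" for s'
  have tail: "\<bar>total_reward \<tau>\<bar> \<le> real n" if "\<tau> \<in> set_pmf (rollout M \<pi> n (Suc h) s')" for \<tau> s'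
    using rollout_total_reward_bounds[OF M that] by simp
  have E: "\<bar>E s'\<bar> \<le> real n" for s'
    unfolding E_def by (intro expectation_abs_le tail)
  have rew: "\<bar>r\<bar> \<le> 1" if "r \<in> set_pmf (reward M h s a)" for r a
    using reward_bounds[OF M that] by simp
  have tail_sum: "measure_pmf.expectation (map_pmf ((#) (s, a, r)) (rollout M \<pi> n (Suc h) s')) total_reward
      = r + E s'" for a r s'
    using integrable_pmf_bounded[of "rollout M \<pi> n (Suc h) s'" total_reward, OF tail] by (simp add: total_reward_def[abs_def] E_def)
  have trans_sum: "measure_pmf.expectation (bind_pmf (trans M h s a)
        (\<lambda>s'. map_pmf ((#) (s, a, r)) (rollout M \<pi> n (Suc h) s'))) total_reward
      = r + measure_pmf.expectation (trans M h s a) E" for a r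
  proof -
    have "\<bar>total_reward ((s, a, r) # \<tau>)\<bar> \<le> \<bar>r\<bar> + real n"
      if "\<tau> \<in> set_pmf (rollout M \<pi> n (Suc h) s')" for \<tau> s'
      using tail[OF that] by (simp add: total_reward_def)
    then show ?thesis
      using integrable_pmf_bounded[of "trans M h s a" E, OF E]
      by (subst expectation_bind[where B = "\<bar>r\<bar> + real n"]) (auto simp: tail_sum simp del: integral_map_pmf)
  qed
  have reward_sum: "measure_pmf.expectation (bind_pmf (reward M h s a) (\<lambda>r. bind_pmf (trans M h s a)
        (\<lambda>s'. map_pmf ((#) (s, a, r)) (rollout M \<pi> n (Suc h) s')))) total_reward
      = measure_pmf.expectation (reward M h s a) (\<lambda>r. r) + measure_pmf.expectation (trans M h s a) E" for a
  proof -
    have "\<bar>total_reward ((s, a, r) # \<tau>)\<bar> \<le> 1 + real n"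
      if "r \<in> set_pmf (reward M h s a)" "\<tau> \<in> set_pmf (rollout M \<pi> n (Suc h) s')" for r \<tau> s'
      using tail[OF that(2)] rew[OF that(1)] by (simp add: total_reward_def)
    then show ?thesis
      using integrable_pmf_bounded[of "reward M h s a" "\<lambda>r. r", OF rew]
      by (subst expectation_bind[where B = "1 + real n"]) (auto simp: trans_sum)
  qed
  have "measure_pmf.expectation (rollout M \<pi> (Suc n) h s) total_reward
      = measure_pmf.expectation (\<pi> h s) (\<lambda>a. measure_pmf.expectation
          (bind_pmf (reward M h s a) (\<lambda>r. bind_pmf (trans M h s a)
            (\<lambda>s'. map_pmf ((#) (s, a, r)) (rollout M \<pi> n (Suc h) s')))) total_reward)"
    unfolding rollout.simps
    by (rule expectation_bind[where B = "real (Suc n)"])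
       (use rollout_total_reward_bounds[OF M, of _ \<pi> "Suc n" h s] in fastforce)
  then show ?thesis
    by (simp only: reward_sum E_def[abs_def])
qed

lemma V_pi_step:
  assumes "valid_mdp M" "h \<le> horizon M"
  shows "V_pi M \<pi> h s = measure_pmf.expectation (\<pi> h s) (Q_pi M \<pi> h s)"
proof -
  have "Suc (horizon M) - h = Suc (Suc (horizon M) - Suc h)"
    using assms(2) by simp
  then show ?thesis
    unfolding V_pi_def Q_pi_def by (simp only: expectation_rollout_Suc[OF assms(1)])
qed

lemma V_pi_end [simp]: "V_pi M \<pi> (Suc (horizon M)) s = 0"
  by (simp add: V_pi_def total_reward_def)

lemma V0_eq_V_pi: "V0 M \<pi> = V_pi M \<pi> 1 (initial M)"
  by (simp add: V0_def V_pi_def episode_def)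

lemma SUP_attained:
  fixes f :: "'b \<Rightarrow> real" and x0 :: 'b
  assumes "\<And>x. f x \<le> u" "f x0 = u"
  shows "(SUP x. f x) = u"
  using assms by (intro cSup_eq_maximum) auto

lemma UNIV_state: "(UNIV :: state set) = {S0, S1, S2}"
  using state.exhaust by auto

lemma UNIV_action: "(UNIV :: action set) = {A1, A2}"
  using action.exhaust by auto

lemma pmf_A2: "pmf P A2 = 1 - pmf P A1"
proof -
  have "(\<Sum>a\<in>{A1, A2}. pmf P a) = 1"
    by (rule sum_pmf_eq_1) (auto intro: action.exhaust)
  then show ?thesis by simp
qed

lemma expectation_action:
  fixes f :: "action \<Rightarrow> real"
  shows "measure_pmf.expectation P f = pmf P A1 * f A1 + (1 - pmf P A1) * f A2"
  by (subst integral_measure_pmf[of "{A1, A2}"]) (auto simp: pmf_A2 intro: action.exhaust)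

text \<open>Both signs of the gap parameters are covered, because the alternative instances of the
  lower bound flip one of them.\<close>

locale two_step_instance =
  fixes \<Delta>1 \<Delta>2 p :: real
  assumes \<Delta>1: "\<bar>\<Delta>1\<bar> \<le> 1 / 2" and \<Delta>2: "\<bar>\<Delta>2\<bar> \<le> 1 / 2" and p: "0 < p" "p < 1 / 2"
begin

abbreviation "M \<equiv> two_step \<Delta>1 \<Delta>2 p"

definition mean :: "state \<Rightarrow> action \<Rightarrow> real" where
  "mean s a = (case s of
       S0 \<Rightarrow> (case a of A1 \<Rightarrow> 1 | A2 \<Rightarrow> 0)
     | S1 \<Rightarrow> (case a of A1 \<Rightarrow> 1 / 2 + \<Delta>1 | A2 \<Rightarrow> 1 / 2)
     | S2 \<Rightarrow> (case a of A1 \<Rightarrow> 1 / 2 + \<Delta>2 | A2 \<Rightarrow> 1 / 2))"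

text \<open>Comparing immediate rewards is optimal at step 1 as well, by
  \<open>Q_star_1_le\<close>.\<close>

definition greedy :: "state \<Rightarrow> action" where
  "greedy s = (if mean s A2 \<le> mean s A1 then A1 else A2)"

definition best :: "state \<Rightarrow> real" where
  "best s = max (mean s A1) (mean s A2)"

lemma horizon [simp]: "horizon M = 2" and initial [simp]: "initial M = S0"
  by (simp_all add: two_step_def)

lemma valid: "valid_mdp M"
  by (auto simp: valid_mdp_def two_step_def bernoulli_reward_def split: state.splits action.splits)

lemma expectation_reward: "measure_pmf.expectation (reward M h s a) (\<lambda>r. r) = mean s a"
  using \<Delta>1 \<Delta>2
  by (cases s; cases a) (auto simp: two_step_def bernoulli_reward_def mean_def abs_le_iff)

lemma trans_S0_A1: "measure_pmf.expectation (trans M h S0 A1) f = (1 - p) * f S1 + p * f S2"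
  for f :: "state \<Rightarrow> real"
  using p by (simp add: two_step_def)

lemma trans_simps [simp]:
  "trans M h S0 A2 = return_pmf S2" "trans M h S1 a = return_pmf S1" "trans M h S2 a = return_pmf S2"
  by (simp_all add: two_step_def)

lemma Q_pi_2: "Q_pi M \<pi> 2 s a = mean s a"
proof -
  have "V_pi M \<pi> (Suc 2) = (\<lambda>_. 0)"
    using V_pi_end[of M \<pi>] by (simp only: horizon fun_eq_iff) simp
  then show ?thesis
    by (simp only: Q_pi_def expectation_reward) simp
qed

lemma V_pi_2: "V_pi M \<pi> 2 s = measure_pmf.expectation (\<pi> 2 s) (mean s)"
  by (simp add: V_pi_step[OF valid] Q_pi_2[abs_def])

lemma Q_pi_1: "Q_pi M \<pi> 1 s a = mean s a + measure_pmf.expectation (trans M 1 s a) (V_pi M \<pi> 2)"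
  by (simp add: Q_pi_def expectation_reward)

lemma V_pi_1: "V_pi M \<pi> 1 s = measure_pmf.expectation (\<pi> 1 s) (Q_pi M \<pi> 1 s)"
  by (simp add: V_pi_step[OF valid])

lemma mean_le_best: "mean s a \<le> best s"
  by (cases a) (auto simp: best_def)

lemma mean_greedy: "mean s (greedy s) = best s"
  by (auto simp: best_def greedy_def)

lemma greedy_S0 [simp]: "greedy S0 = A1"
  by (simp add: greedy_def mean_def)

lemma best_S0: "best S0 = 1"
  by (simp add: best_def mean_def)

lemma best_bounds: "1 / 2 \<le> best s" "best s \<le> 1"
  using \<Delta>1 \<Delta>2 by (cases s; auto simp: best_def mean_def abs_le_iff)+

lemma V_pi_2_le: "V_pi M \<pi> 2 s \<le> best s"
  unfolding V_pi_2
proof (rule expectation_le_const[where l = "min (mean s A1) (mean s A2)"])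
  show "min (mean s A1) (mean s A2) \<le> mean s a" for a
    by (cases a) auto
qed (rule mean_le_best)

lemma V_pi_2_greedy: "V_pi M (\<lambda>h s. return_pmf (greedy s)) 2 s = best s"
  by (simp add: V_pi_2 mean_greedy)

lemma V_star_2: "V_star M 2 s = best s"
  unfolding V_star_def by (rule SUP_attained) (rule V_pi_2_le V_pi_2_greedy)+

lemma Q_star_2: "Q_star M 2 s a = mean s a"
  by (simp add: Q_star_def Q_pi_2)

lemma Q_pi_1_le: "Q_pi M \<pi> 1 s a \<le> mean s a + measure_pmf.expectation (trans M 1 s a) best"
  unfolding Q_pi_1
  using p V_pi_2_le[of \<pi>]
  by (cases s; cases a) (auto simp: trans_S0_A1 intro!: add_mono mult_left_mono)

lemma Q_star_1: "Q_star M 1 s a = mean s a + measure_pmf.expectation (trans M 1 s a) best"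
  unfolding Q_star_def
  by (rule SUP_attained[where ?x0.0 = "\<lambda>h s. return_pmf (greedy s)"], rule Q_pi_1_le)
     (simp add: Q_pi_1 V_pi_2_greedy[abs_def])

text \<open>The expression is the gap of \<open>A2\<close> in \<open>S0\<close> at step 1. Best
  values lie between 1/2 and 1, so the better future after \<open>A2\<close> recovers at most
  \<open>(1 - p) / 2\<close> of the lost reward 1.\<close>

lemma gap_S0: "1 / 2 < 1 + (1 - p) * (best S1 - best S2)"
proof -
  have "(1 - p) * (best S1 - best S2) \<ge> (1 - p) * (- 1 / 2)"
    using p best_bounds[of S1] best_bounds[of S2] by (intro mult_left_mono) auto
  moreover have "(1 - p) * (- 1 / 2) = p / 2 - 1 / 2"
    by (simp add: field_simps)
  ultimately show ?thesis using p by linarith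
qed

lemma Q_star_1_le: "Q_star M 1 s a \<le> Q_star M 1 s (greedy s)"
proof (cases "s = S0")
  case True
  have "mean S0 A1 = 1" "mean S0 A2 = 0" by (simp_all add: mean_def)
  then show ?thesis
    using gap_S0 True by (cases a) (auto simp: Q_star_1 trans_S0_A1 algebra_simps)
next
  case False
  then show ?thesis
    using mean_le_best[of s a] by (cases s) (auto simp: Q_star_1 mean_greedy)
qed

lemma V_star_1: "V_star M 1 s = Q_star M 1 s (greedy s)"
  unfolding V_star_def
proof (rule SUP_attained[where ?x0.0 = "\<lambda>h s. return_pmf (greedy s)"])
  show "V_pi M (\<lambda>h s. return_pmf (greedy s)) 1 s = Q_star M 1 s (greedy s)"
    by (simp only: V_pi_1 expectation_return_pmf Q_pi_1 V_pi_2_greedy[abs_def] Q_star_1)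
  fix \<pi>
  have le: "Q_pi M \<pi> 1 s a \<le> Q_star M 1 s (greedy s)" for a
    using Q_pi_1_le[of \<pi> s a] Q_star_1_le[of s a] by (simp add: Q_star_1)
  have "V_pi M \<pi> 1 s \<le> pmf (\<pi> 1 s) A1 * Q_star M 1 s (greedy s) + (1 - pmf (\<pi> 1 s) A1) * Q_star M 1 s (greedy s)"
    unfolding V_pi_1 expectation_action
    by (intro add_mono mult_left_mono le) (auto simp: pmf_le_1)
  then show "V_pi M \<pi> 1 s \<le> Q_star M 1 s (greedy s)"
    by (simp add: algebra_simps)
qed

lemma gap_2: "gap M 2 s a = best s - mean s a"
  by (simp add: gap_def V_star_2 Q_star_2)

lemma gap_1_S0: "gap M 1 S0 A1 = 0" "gap M 1 S0 A2 = 1 + (1 - p) * (best S1 - best S2)"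
  by (simp_all add: gap_def V_star_1 Q_star_1 trans_S0_A1 mean_def algebra_simps)

lemma gap_1: "s \<noteq> S0 \<Longrightarrow> gap M 1 s a = best s - mean s a"
  by (cases s) (simp_all add: gap_def V_star_1 Q_star_1 mean_greedy)

lemma V0_star_eq: "V0_star M = V_star M 1 S0"
  by (simp add: V0_star_def V_star_def V0_eq_V_pi[abs_def])

lemma V0_bounds: "0 \<le> V0 M \<pi>" "V0 M \<pi> \<le> V0_star M"
proof -
  show "0 \<le> V0 M \<pi>"
    unfolding V0_def episode_def
    using rollout_total_reward_bounds[OF valid]
    by (intro expectation_ge_const[where u = 2]) fastforce+
  show "V0 M \<pi> \<le> V0_star M"
    unfolding V0_star_def using rollout_total_reward_bounds[OF valid]
    by (intro cSUP_upper bdd_aboveI2[where M = 2])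
       (auto simp: V0_def episode_def intro!: expectation_le_const[where l = 0], fastforce+)
qed

text \<open>Performance difference: the loss at each state is weighted by its probability of being
  reached under \<open>\<pi>\<close>.\<close>

lemma suboptimality:
  "V0_star M - V0 M \<pi> =
     (1 - pmf (\<pi> 1 S0) A1) * gap M 1 S0 A2
     + pmf (\<pi> 1 S0) A1 * (1 - p) * (best S1 - V_pi M \<pi> 2 S1)
     + (1 - pmf (\<pi> 1 S0) A1 * (1 - p)) * (best S2 - V_pi M \<pi> 2 S2)"
  by (simp add: V0_star_eq V0_eq_V_pi V_star_1 Q_star_1 V_pi_1 Q_pi_1
        expectation_action trans_S0_A1 gap_1_S0 mean_def algebra_simps)

text \<open>Every term of \<open>suboptimality\<close> is nonnegative, and the first carries a gap
  above 1/2. This is what makes exploration through \<open>A2\<close> expensive in regret.\<close>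

lemma suboptimality_ge: "(1 - pmf (\<pi> 1 S0) A1) / 2 \<le> V0_star M - V0 M \<pi>"
proof -
  define q where "q = pmf (\<pi> 1 S0) A1"
  have q: "0 \<le> q" "q \<le> 1" by (auto simp: q_def pmf_le_1)
  have "(1 - q) * (1 / 2) \<le> (1 - q) * gap M 1 S0 A2"
    using q gap_S0 by (intro mult_left_mono) (auto simp: gap_1_S0)
  moreover have "0 \<le> q * (1 - p) * (best S1 - V_pi M \<pi> 2 S1)"
    using q p V_pi_2_le by (intro mult_nonneg_nonneg) auto
  moreover have "q * (1 - p) \<le> 1 * 1"
    using q p by (intro mult_mono) auto
  then have "0 \<le> (1 - q * (1 - p)) * (best S2 - V_pi M \<pi> 2 S2)"
    using V_pi_2_le by (intro mult_nonneg_nonneg) auto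
  ultimately show ?thesis
    unfolding suboptimality q_def[symmetric] by argo
qed

text \<open>An optimal policy plays \<open>A1\<close> in \<open>S0\<close>, and then reaches both
  \<open>S1\<close> and \<open>S2\<close> with positive probability, so no loss is possible in
  either.\<close>

lemma optimal_imp_greedy:
  assumes "optimal M \<pi>"
  shows "V_pi M \<pi> 2 S1 = best S1" "V_pi M \<pi> 2 S2 = best S2"
proof -
  define q where "q = pmf (\<pi> 1 S0) A1"
  have q1: "q = 1"
    using suboptimality_ge[of \<pi>] assms pmf_le_1[of "\<pi> 1 S0" A1] by (simp add: q_def optimal_def)
  have "(1 - p) * (best S1 - V_pi M \<pi> 2 S1) + p * (best S2 - V_pi M \<pi> 2 S2) = 0"
    using suboptimality[of \<pi>] assms q1 unfolding optimal_def q_def by simp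
  moreover have "0 \<le> (1 - p) * (best S1 - V_pi M \<pi> 2 S1)" "0 \<le> p * (best S2 - V_pi M \<pi> 2 S2)"
    using p V_pi_2_le by (auto intro!: mult_nonneg_nonneg)
  ultimately have "(1 - p) * (best S1 - V_pi M \<pi> 2 S1) = 0" "p * (best S2 - V_pi M \<pi> 2 S2) = 0"
    by linarith+
  then show "V_pi M \<pi> 2 S1 = best S1" "V_pi M \<pi> 2 S2 = best S2"
    using p by auto
qed

lemma optimal_imp_sign:
  assumes "optimal M \<pi>"
  shows "0 < \<Delta>1 \<Longrightarrow> pmf (\<pi> 2 S1) A1 = 1" "\<Delta>1 < 0 \<Longrightarrow> pmf (\<pi> 2 S1) A1 = 0"
    and "0 < \<Delta>2 \<Longrightarrow> pmf (\<pi> 2 S2) A1 = 1" "\<Delta>2 < 0 \<Longrightarrow> pmf (\<pi> 2 S2) A1 = 0"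
  using optimal_imp_greedy[OF assms]
  by (auto simp: V_pi_2 expectation_action best_def mean_def algebra_simps)

end

section \<open>Complexity\<close>

context two_step_instance
begin

text \<open>Projecting an episode to the pair seen at one step turns visit probabilities into point
  masses. Index 0 is step 1.\<close>

lemma map_episode_1: "map_pmf (\<lambda>\<tau>. (fst (\<tau> ! 0), fst (snd (\<tau> ! 0)))) (episode M \<pi>) = map_pmf (Pair S0) (\<pi> 1 S0)"
  by (simp add: episode_def numeral_2_eq_2 map_bind_pmf bind_map_pmf pmf.map_comp o_def map_pmf_def bind_assoc_pmf bind_return_pmf)

lemma map_episode_2: "map_pmf (\<lambda>\<tau>. (fst (\<tau> ! 1), fst (snd (\<tau> ! 1)))) (episode M \<pi>) =
    bind_pmf (\<pi> 1 S0) (\<lambda>a. bind_pmf (trans M 1 S0 a) (\<lambda>s. map_pmf (Pair s) (\<pi> 2 s)))"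
  by (simp add: episode_def numeral_2_eq_2 map_bind_pmf bind_map_pmf pmf.map_comp o_def map_pmf_def bind_assoc_pmf bind_return_pmf)

lemma w_visit_le_1: "w_visit M \<pi> h s a \<le> 1"
  by (simp add: w_visit_def)

lemma w_visit_1: "w_visit M \<pi> 1 S0 a = pmf (\<pi> 1 S0) a"
proof -
  have "w_visit M \<pi> 1 S0 a = pmf (map_pmf (\<lambda>\<tau>. (fst (\<tau> ! 0), fst (snd (\<tau> ! 0)))) (episode M \<pi>)) (S0, a)"
    by (simp add: w_visit_def pmf_map vimage_def)
  then show ?thesis
    by (simp add: map_episode_1 pmf_map_inj' inj_on_def)
qed

lemma w_visit_2:
  "w_visit M \<pi> 2 S1 a = pmf (\<pi> 1 S0) A1 * (1 - p) * pmf (\<pi> 2 S1) a"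
  "w_visit M \<pi> 2 S2 a = (1 - pmf (\<pi> 1 S0) A1 * (1 - p)) * pmf (\<pi> 2 S2) a"
proof -
  have *: "w_visit M \<pi> 2 s a = pmf (map_pmf (\<lambda>\<tau>. (fst (\<tau> ! 1), fst (snd (\<tau> ! 1)))) (episode M \<pi>)) (s, a)" for s
    by (simp add: w_visit_def pmf_map vimage_def One_nat_def)
  have inj: "pmf (map_pmf (Pair s) P) (s', a) = (if s = s' then pmf P a else 0)" for s s' and P :: "action pmf"
  proof (cases "s = s'")
    case True
    then show ?thesis by (simp add: pmf_map_inj' inj_on_def)
  next
    case False
    then show ?thesis by (auto intro!: pmf_map_outside)
  qed
  show "w_visit M \<pi> 2 S1 a = pmf (\<pi> 1 S0) A1 * (1 - p) * pmf (\<pi> 2 S1) a"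
    "w_visit M \<pi> 2 S2 a = (1 - pmf (\<pi> 1 S0) A1 * (1 - p)) * pmf (\<pi> 2 S2) a"
    unfolding * map_episode_2
    by (simp_all add: pmf_bind expectation_action trans_S0_A1 inj algebra_simps)
qed

definition state_prob :: "(state, action) policy \<Rightarrow> nat \<Rightarrow> state \<Rightarrow> real" where
  "state_prob \<pi> h s = measure_pmf.prob (episode M \<pi>) {\<tau>. fst (\<tau> ! (h - 1)) = s}"

lemma state_prob_eq:
  "state_prob \<pi> h s = pmf (map_pmf fst (map_pmf (\<lambda>\<tau>. (fst (\<tau> ! (h - 1)), fst (snd (\<tau> ! (h - 1))))) (episode M \<pi>))) s"
  by (simp add: state_prob_def pmf_map vimage_def pmf.map_comp o_def)

lemma state_prob_1: "state_prob \<pi> 1 s = of_bool (s = S0)"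
  by (simp add: state_prob_eq map_episode_1[unfolded One_nat_def] pmf.map_comp o_def indicator_def)

lemma state_prob_2:
  "state_prob \<pi> 2 S0 = 0"
  "state_prob \<pi> 2 S1 = pmf (\<pi> 1 S0) A1 * (1 - p)"
  "state_prob \<pi> 2 S2 = 1 - pmf (\<pi> 1 S0) A1 * (1 - p)"
proof -
  have step: "(2::nat) - 1 = 1" by simp
  have "map_pmf fst (map_pmf (\<lambda>\<tau>. (fst (\<tau> ! 1), fst (snd (\<tau> ! 1)))) (episode M \<pi>))
      = bind_pmf (\<pi> 1 S0) (trans M 1 S0)"
    unfolding map_episode_2 by (simp add: map_bind_pmf pmf.map_comp o_def bind_return_pmf')
  then have *: "state_prob \<pi> 2 s = pmf (bind_pmf (\<pi> 1 S0) (trans M 1 S0)) s" for s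
    unfolding state_prob_eq step by simp
  have trans: "pmf (trans M 1 S0 A1) s = (1 - p) * indicator {s} S1 + p * indicator {s} S2" for s
    using trans_S0_A1[of 1 "indicator {s}"] by (simp add: measure_pmf_single)
  show "state_prob \<pi> 2 S0 = 0" "state_prob \<pi> 2 S1 = pmf (\<pi> 1 S0) A1 * (1 - p)"
    "state_prob \<pi> 2 S2 = 1 - pmf (\<pi> 1 S0) A1 * (1 - p)"
    by (simp_all add: * pmf_bind expectation_action trans algebra_simps)
qed

lemma state_prob_le_1: "state_prob \<pi> h s \<le> 1"
  by (simp add: state_prob_def)

lemma W_reach_eq: "W_reach M h s = (SUP \<pi>. state_prob \<pi> h s)"
  by (simp add: W_reach_def state_prob_def)

lemma W_reach_le_1: "W_reach M h s \<le> 1"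
  unfolding W_reach_eq by (intro cSUP_least state_prob_le_1) simp

lemma state_prob_le_W_reach: "state_prob \<pi> h s \<le> W_reach M h s"
  unfolding W_reach_eq by (intro cSUP_upper bdd_aboveI2[where M = 1] state_prob_le_1) simp

text \<open>Always playing \<open>A1\<close> reaches \<open>S1\<close> with probability
  \<open>1 - p\<close>; always playing \<open>A2\<close> reaches \<open>S2\<close> surely.\<close>

lemma W_reach_ge:
  "1 \<le> W_reach M 1 S0" "1 / 2 \<le> W_reach M 2 S1" "1 \<le> W_reach M 2 S2"
  using state_prob_le_W_reach[of "\<lambda>_ _. return_pmf A1" 1 S0]
    state_prob_le_W_reach[of "\<lambda>_ _. return_pmf A1" 2 S1]
    state_prob_le_W_reach[of "\<lambda>_ _. return_pmf A2" 2 S2] p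
  by (simp_all add: state_prob_1 state_prob_2)

lemma can_occur_iff: "can_occur M h s \<longleftrightarrow> (h, s) \<in> {(1, S0), (2, S1), (2, S2)}"
proof -
  have "W_reach M 1 S1 = 0" "W_reach M 1 S2 = 0" "W_reach M 2 S0 = 0"
    by (simp_all add: W_reach_eq state_prob_1 state_prob_2)
  moreover have "h = 1 \<or> h = 2" if "1 \<le> h" "h \<le> 2" using that by linarith
  ultimately show ?thesis
    using W_reach_ge by (cases s) (auto simp: can_occur_def)
qed

end

section \<open>Gaps, complexity and \<open>eps_star\<close> when \<open>A1\<close> is optimal
  everywhere\<close>

locale positive_gaps = two_step_instance +
  assumes pos: "0 < \<Delta>1" "0 < \<Delta>2"
begin

lemma best_eq: "best S1 = 1 / 2 + \<Delta>1" "best S2 = 1 / 2 + \<Delta>2"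
  using pos by (simp_all add: best_def mean_def)

text \<open>All states are treated at both steps, since \<open>unique_optimal_actions\<close> also
  ranges over states that cannot occur.\<close>

lemma gap_A1: "1 \<le> h \<Longrightarrow> h \<le> 2 \<Longrightarrow> gap M h s A1 = 0"
proof -
  assume "1 \<le> h" "h \<le> 2"
  then consider "h = 1" | "h = 2" by linarith
  then show "gap M h s A1 = 0"
    using pos by cases (cases s; auto simp: gap_1_S0 gap_1 gap_2 best_S0 best_eq mean_def)+
qed

lemma gap_2_A2: "gap M 2 S0 A2 = 1" "gap M 2 S1 A2 = \<Delta>1" "gap M 2 S2 A2 = \<Delta>2"
  by (simp_all add: gap_2 best_S0 best_eq mean_def)

lemma gap_1_A2: "1 / 2 < gap M 1 S0 A2" "gap M 1 S0 A2 \<le> 3 / 2" "gap M 1 S1 A2 = \<Delta>1" "gap M 1 S2 A2 = \<Delta>2"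
proof -
  show "1 / 2 < gap M 1 S0 A2" using gap_S0 by (simp add: gap_1_S0)
  have "(1 - p) * (best S1 - best S2) \<le> (1 - p) * (1 / 2)"
    using p \<Delta>1 pos by (intro mult_left_mono) (auto simp: best_eq)
  also have "\<dots> \<le> 1 / 2" using p by (simp add: field_simps)
  finally show "gap M 1 S0 A2 \<le> 3 / 2" by (simp add: gap_1_S0)
  show "gap M 1 S1 A2 = \<Delta>1" "gap M 1 S2 A2 = \<Delta>2"
    by (simp_all add: gap_1 best_eq mean_def)
qed

lemma gap_A2_pos: "1 \<le> h \<Longrightarrow> h \<le> 2 \<Longrightarrow> 0 < gap M h s A2"
proof -
  assume "1 \<le> h" "h \<le> 2"
  then consider "h = 1" | "h = 2" by linarith
  then show "0 < gap M h s A2"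
    using pos gap_1_A2 gap_2_A2 by cases (cases s; auto)+
qed

lemma gap_pos_iff: "1 \<le> h \<Longrightarrow> h \<le> 2 \<Longrightarrow> 0 < gap M h s a \<longleftrightarrow> a = A2"
  using gap_A1 gap_A2_pos by (cases a) auto

lemma unique_optimal_actions: "unique_optimal_actions M"
  unfolding unique_optimal_actions_def
proof (intro ballI allI ex1I[of _ A1])
  fix h s a assume "h \<in> {1..horizon M}"
  then have h: "1 \<le> h" "h \<le> 2" by auto
  show "gap M h s A1 = 0" using h by (rule gap_A1)
  assume "gap M h s a = 0"
  then show "a = A1" using gap_A2_pos[OF h, of s] by (cases a) auto
qed

lemma gap_tilde_eq:
  assumes "1 \<le> h" "h \<le> 2"
  shows "gap_tilde M h s a = gap M h s A2"
proof -
  have "{gap M h s a' |a'. gap M h s a' > 0} = {gap M h s A2}"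
    by (auto simp: gap_pos_iff[OF assms])
  then show ?thesis
    by (cases a) (simp_all add: gap_tilde_def gap_pos_iff[OF assms])
qed

lemma complexity_eq:
  "complexity M = (INF \<pi>. 1 / ennreal (w_visit M \<pi> 1 S0 A2 * (gap M 1 S0 A2)\<^sup>2))
     + (INF \<pi>. max (1 / ennreal (w_visit M \<pi> 2 S1 A2 * \<Delta>1\<^sup>2)) (1 / ennreal (w_visit M \<pi> 2 S2 A2 * \<Delta>2\<^sup>2)))"
proof -
  have 1: "{(s, a). can_occur M 1 s \<and> gap M 1 s a > 0} = {(S0, A2)}"
    by (auto simp: can_occur_iff gap_pos_iff)
  have 2: "{(s, a). can_occur M 2 s \<and> gap M 2 s a > 0} = {(S1, A2), (S2, A2)}"
    by (auto simp: can_occur_iff gap_pos_iff)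
  have "{1..horizon M} = {1, 2}" by auto
  then show ?thesis
    by (simp add: complexity_def 1 2 gap_2_A2 sup_max)
qed

text \<open>The infimum is taken separately at each step, so each step gets its own exploration
  policy: \<open>\<pi>1\<close> plays \<open>A2\<close> at once, \<open>\<pi>2\<close> mixes evenly
  in \<open>S0\<close> and then plays \<open>A2\<close>. The constant is 1 + 4.\<close>

lemma complexity_le: "complexity M \<le> ennreal (5 * (1 / \<Delta>1\<^sup>2 + 1 / \<Delta>2\<^sup>2))"
proof -
  define \<pi>1 \<pi>2 :: "(state, action) policy" where "\<pi>1 = (\<lambda>_ _. return_pmf A2)"
    and "\<pi>2 h s = (if h = 1 then map_pmf (\<lambda>b. if b then A1 else A2) (bernoulli_pmf (1 / 2)) else return_pmf A2)" for h s
  have sq: "0 < \<Delta>1\<^sup>2" "0 < \<Delta>2\<^sup>2" using pos by auto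
  \<comment> \<open>Step 1 contributes at most 4, which is at most
    \<open>1 / \<Delta>1\<^sup>2\<close> because \<open>\<Delta>1 \<le> 1 / 2\<close>.\<close>
  have "(1 / 2)\<^sup>2 \<le> (gap M 1 S0 A2)\<^sup>2"
    using gap_1_A2 by (intro power_mono) auto
  then have "1 / (gap M 1 S0 A2)\<^sup>2 \<le> 1 / (1 / 2)\<^sup>2"
    using gap_1_A2(1) by (intro divide_left_mono mult_pos_pos) auto
  also have "\<dots> \<le> 1 / \<Delta>1\<^sup>2"
    using pos \<Delta>1 by (intro divide_left_mono power_mono) auto
  finally have "1 / ennreal (w_visit M \<pi>1 1 S0 A2 * (gap M 1 S0 A2)\<^sup>2) \<le> ennreal (1 / \<Delta>1\<^sup>2)"
    using gap_1_A2 by (simp add: w_visit_1 \<pi>1_def divide_ennreal flip: ennreal_1)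
  then have 1: "(INF \<pi>. 1 / ennreal (w_visit M \<pi> 1 S0 A2 * (gap M 1 S0 A2)\<^sup>2)) \<le> ennreal (1 / \<Delta>1\<^sup>2)"
    by (intro INF_lower2[where i = \<pi>1]) auto
  have q: "pmf (\<pi>2 1 S0) A1 = 1 / 2"
  proof -
    have "{b. b} = {True}" by auto
    then show ?thesis by (simp add: \<pi>2_def pmf_map vimage_def measure_pmf_single)
  qed
  \<comment> \<open>The visit probabilities are \<open>(1 - p) / 2\<close> and
    \<open>(1 + p) / 2\<close>, with \<open>p\<close> below 1/2.\<close>
  have w: "1 / 4 \<le> w_visit M \<pi>2 2 S1 A2" "1 / 4 \<le> w_visit M \<pi>2 2 S2 A2"
    using p by (simp_all add: w_visit_2 q) (simp_all add: \<pi>2_def field_simps)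
  have inv: "1 / ennreal (w * g) \<le> ennreal (4 / g)" if "1 / 4 \<le> w" "0 < g" for w g :: real
  proof -
    have "1 / (w * g) \<le> 1 / (1 / 4 * g)"
      using that by (intro divide_left_mono mult_right_mono) auto
    then show ?thesis using that by (simp add: divide_ennreal flip: ennreal_1)
  qed
  have "max (1 / ennreal (w_visit M \<pi>2 2 S1 A2 * \<Delta>1\<^sup>2)) (1 / ennreal (w_visit M \<pi>2 2 S2 A2 * \<Delta>2\<^sup>2))
      \<le> ennreal (4 / \<Delta>1\<^sup>2 + 4 / \<Delta>2\<^sup>2)"
    using inv[OF w(1) sq(1)] inv[OF w(2) sq(2)] sq
    by (auto intro!: order_trans[OF inv[OF w(1) sq(1)]] order_trans[OF inv[OF w(2) sq(2)]] ennreal_leI)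
  then have 2: "(INF \<pi>. max (1 / ennreal (w_visit M \<pi> 2 S1 A2 * \<Delta>1\<^sup>2)) (1 / ennreal (w_visit M \<pi> 2 S2 A2 * \<Delta>2\<^sup>2)))
      \<le> ennreal (4 / \<Delta>1\<^sup>2 + 4 / \<Delta>2\<^sup>2)"
    by (intro INF_lower2[where i = \<pi>2]) auto
  have "complexity M \<le> ennreal (1 / \<Delta>1\<^sup>2) + ennreal (4 / \<Delta>1\<^sup>2 + 4 / \<Delta>2\<^sup>2)"
    unfolding complexity_eq by (rule add_mono[OF 1 2])
  also have "\<dots> = ennreal (1 / \<Delta>1\<^sup>2 + (4 / \<Delta>1\<^sup>2 + 4 / \<Delta>2\<^sup>2))"
    using sq by (subst ennreal_plus) auto
  also have "\<dots> \<le> ennreal (5 * (1 / \<Delta>1\<^sup>2 + 1 / \<Delta>2\<^sup>2))"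
    using sq by (intro ennreal_leI) (simp add: field_simps)
  finally show ?thesis .
qed

lemma complexity_ge: "ennreal (1 / (min \<Delta>1 \<Delta>2)\<^sup>2) \<le> complexity M"
proof -
  have inv: "ennreal (1 / g) \<le> 1 / ennreal (w_visit M \<pi> 2 s a * g)" if "0 < g" for g \<pi> s a
  proof (cases "w_visit M \<pi> 2 s a = 0")
    \<comment> \<open>An unvisited pair contributes \<open>1 / 0\<close>, which is infinite in
      \<open>ennreal\<close>.\<close>
    case True
    then show ?thesis by (simp add: ennreal_divide_zero)
  next
    case False
    then have w: "0 < w_visit M \<pi> 2 s a" by (simp add: w_visit_def less_le)
    have "1 / (1 * g) \<le> 1 / (w_visit M \<pi> 2 s a * g)"
      using w that w_visit_le_1 by (intro divide_left_mono mult_right_mono) auto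
    then show ?thesis using w that by (simp add: divide_ennreal flip: ennreal_1)
  qed
  have "ennreal (1 / (min \<Delta>1 \<Delta>2)\<^sup>2)
      \<le> (INF \<pi>. max (1 / ennreal (w_visit M \<pi> 2 S1 A2 * \<Delta>1\<^sup>2)) (1 / ennreal (w_visit M \<pi> 2 S2 A2 * \<Delta>2\<^sup>2)))"
    using inv[of "\<Delta>1\<^sup>2"] inv[of "\<Delta>2\<^sup>2"] pos
    by (intro INF_greatest) (auto simp: min_def le_max_iff_disj)
  then show ?thesis
    unfolding complexity_eq by (rule add_increasing[OF zero_le])
qed

text \<open>Reachable states have reach probability at least 1/2 and gap at least
  \<open>min \<Delta>1 \<Delta>2\<close>, giving the factor 1/6. The upper bound comes from
  \<open>S1\<close> at step 2 and later ensures that \<open>ln (1 / eps_star M)\<close> is at least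
  1.\<close>

lemma eps_star_bounds:
  "min \<Delta>1 \<Delta>2 / 6 \<le> eps_star M" "eps_star M \<le> 1 / 6"
proof -
  define X where "X = {W_reach M h s * gap_tilde M h s a / 3 |h s a. can_occur M h s}"
  define Y where "Y = {W_reach M h s |h s. can_occur M h s}"
  \<comment> \<open>\<open>h\<close> ranges over all naturals in \<open>X\<close>, so finiteness
    rests on \<open>can_occur\<close> restricting it to 1 and 2.\<close>
  have "X \<subseteq> (\<Union>h\<in>{1, 2}. \<Union>s. \<Union>a. {W_reach M h s * gap_tilde M h s a / 3})"
    unfolding X_def can_occur_iff by blast
  then have finX: "finite X" by (rule finite_subset) auto
  have "Y \<subseteq> (\<Union>h\<in>{1, 2}. \<Union>s. {W_reach M h s})"
    unfolding Y_def can_occur_iff by blast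
  then have finY: "finite Y" by (rule finite_subset) auto
  have eq: "eps_star M = min (Min X) (2 * real (horizon M)^2 * real CARD(state) * Min Y)"
    by (simp add: eps_star_def X_def Y_def)
  have "W_reach M 2 S1 * gap_tilde M 2 S1 A1 / 3 \<in> X"
    unfolding X_def by (auto simp: can_occur_iff)
  then have X: "X \<noteq> {}" and "Min X \<le> W_reach M 2 S1 * gap_tilde M 2 S1 A1 / 3"
    using Min_le[OF finX] by blast+
  note this(2)
  also have "W_reach M 2 S1 * gap_tilde M 2 S1 A1 / 3 = W_reach M 2 S1 * \<Delta>1 / 3" by (simp add: gap_tilde_eq gap_2_A2)
  also have "\<dots> \<le> 1 * (1 / 2) / 3"
    using \<Delta>1 pos W_reach_le_1 by (intro divide_right_mono mult_mono) auto
  finally show "eps_star M \<le> 1 / 6" by (simp add: eq)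
  have "W_reach M 1 S0 \<in> Y"
    unfolding Y_def by (auto simp: can_occur_iff)
  then have Y: "Y \<noteq> {}" by blast
  define m where "m = min \<Delta>1 \<Delta>2"
  have m: "0 < m" "m \<le> \<Delta>1" "m \<le> \<Delta>2" "m \<le> 1 / 2" using pos \<Delta>1 by (auto simp: m_def)
  have "m / 6 \<le> Min X"
    unfolding Min_ge_iff[OF finX X]
  proof
    fix x assume "x \<in> X"
    then obtain h s a where x: "x = W_reach M h s * gap_tilde M h s a / 3" and hs: "can_occur M h s"
      by (auto simp: X_def)
    have "m \<le> gap_tilde M h s a" "1 / 2 \<le> W_reach M h s"
      using hs W_reach_ge m gap_1_A2 gap_2_A2 by (auto simp: can_occur_iff gap_tilde_eq)
    then have "1 / 2 * m / 3 \<le> W_reach M h s * gap_tilde M h s a / 3"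
      using m by (intro divide_right_mono mult_mono) auto
    then show "m / 6 \<le> x" by (simp add: x)
  qed
  moreover have "1 / 2 \<le> Min Y"
    unfolding Min_ge_iff[OF finY Y] using W_reach_ge by (auto simp: Y_def can_occur_iff)
  then have "m / 6 \<le> 2 * real (horizon M)^2 * real CARD(state) * Min Y"
    using m by (simp add: UNIV_state)
  ultimately show "min \<Delta>1 \<Delta>2 / 6 \<le> eps_star M"
    by (simp add: eq m_def)
qed

end

section \<open>The lower bound for low-regret algorithms\<close>

lemma length_collect: "d \<in> set_pmf (collect M alg K) \<Longrightarrow> length d = K"
  by (induction K arbitrary: d) auto

lemma abs_sum_list_le:
  fixes f :: "'a \<Rightarrow> real"
  assumes "\<And>x. \<bar>f x\<bar> \<le> B"
  shows "\<bar>\<Sum>x\<leftarrow>d. f (fst x)\<bar> \<le> real (length d) * B"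
proof (induction d)
  case (Cons x d)
  then show ?case using assms[of "fst x"] by (simp add: algebra_simps abs_le_iff)
qed simp

lemma abs_sum_collect_le:
  fixes f :: "('s, 'a) policy \<Rightarrow> real"
  assumes "\<And>\<pi>. \<bar>f \<pi>\<bar> \<le> B" "d \<in> set_pmf (collect M alg K)"
  shows "\<bar>\<Sum>x\<leftarrow>d. f (fst x)\<bar> \<le> real K * B"
  using abs_sum_list_le[of f B d] assms length_collect[OF assms(2)] by simp

text \<open>Peels off the last episode by conditioning on the earlier data, matching the induction
  in \<open>KL_le_collect\<close>.\<close>

lemma expectation_collect_Suc:
  fixes f :: "('s, 'a) policy \<Rightarrow> real"
  assumes f: "\<And>\<pi>. \<bar>f \<pi>\<bar> \<le> B"
  shows "measure_pmf.expectation (collect M alg (Suc K)) (\<lambda>d. \<Sum>x\<leftarrow>d. f (fst x)) =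
    measure_pmf.expectation (collect M alg K)
      (\<lambda>d. (\<Sum>x\<leftarrow>d. f (fst x)) + measure_pmf.expectation (alg d) f)"
proof -
  have int: "integrable (measure_pmf P) f" for P
    using f by (rule integrable_pmf_bounded)
  have inner: "measure_pmf.expectation (bind_pmf (alg d) (\<lambda>\<pi>. map_pmf (\<lambda>\<tau>. d @ [(\<pi>, \<tau>)]) (episode M \<pi>)))
      (\<lambda>d. \<Sum>x\<leftarrow>d. f (fst x)) = (\<Sum>x\<leftarrow>d. f (fst x)) + measure_pmf.expectation (alg d) f" for d
  proof -
    have "\<bar>(\<Sum>x\<leftarrow>d. f (fst x)) + f \<pi>\<bar> \<le> real (length d) * B + B" for \<pi>
      using abs_sum_list_le[of f B d, OF f] f[of \<pi>] by linarith
    then show ?thesis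
      using int by (subst expectation_bind[where B = "real (length d) * B + B"]) auto
  qed
  show ?thesis
    unfolding collect.simps
    by (subst expectation_bind[where B = "real (Suc K) * B"])
       (rule abs_sum_collect_le[of f, OF f], simp_all only: inner collect.simps)
qed

text \<open>Brings the regret into the form of the entropy cost in \<open>KL_le_collect\<close>, so
  that the two can be compared episode by episode.\<close>

lemma expected_regret_eq:
  assumes "\<And>\<pi>. \<bar>V0_star M - V0 M \<pi>\<bar> \<le> B"
  shows "expected_regret M alg K =
    measure_pmf.expectation (collect M alg K) (\<lambda>d. \<Sum>x\<leftarrow>d. V0_star M - V0 M (fst x))"
proof -
  have "expected_regret M alg K =
      measure_pmf.expectation (collect M alg K) (\<lambda>d. \<Sum>k<K. V0_star M - V0 M (fst (d ! k)))"
    unfolding expected_regret_def using assms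
    by (intro Bochner_Integration.integral_sum[symmetric] integrable_pmf_bounded)
  also have "\<dots> = measure_pmf.expectation (collect M alg K) (\<lambda>d. \<Sum>x\<leftarrow>d. V0_star M - V0 M (fst x))"
    by (intro integral_cong_AE)
       (auto simp: AE_measure_pmf_iff sum_list_sum_nth atLeast0LessThan dest: length_collect)
  finally show ?thesis .
qed

text \<open>Divergence decomposition: the algorithm chooses its policy from the data by the same
  kernel on both instances, so only the episodes themselves cost relative entropy.\<close>

lemma KL_le_collect:
  assumes c: "\<And>\<pi>. KL_le (episode M \<pi>) (episode M' \<pi>) (c \<pi>)" "\<And>\<pi>. \<bar>c \<pi>\<bar> \<le> C"
  shows "KL_le (collect M alg K) (collect M' alg K)
    (measure_pmf.expectation (collect M alg K) (\<lambda>d. \<Sum>x\<leftarrow>d. c (fst x)))"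
proof (induction K)
  case 0
  then show ?case by (simp add: KL_le_refl)
next
  case (Suc K)
  have cost: "\<bar>measure_pmf.expectation P c\<bar> \<le> C" for P
    using c(2) by (rule expectation_abs_le)
  have "KL_le (collect M alg (Suc K)) (collect M' alg (Suc K))
    (measure_pmf.expectation (collect M alg K) (\<lambda>d. \<Sum>x\<leftarrow>d. c (fst x))
     + measure_pmf.expectation (collect M alg K) (\<lambda>d. measure_pmf.expectation (alg d) c))"
    unfolding collect.simps
    by (rule KL_le_bind[OF Suc, where C = C], rule KL_le_bind_same[where C = C], rule KL_le_map)
       (rule c cost)+
  also have "measure_pmf.expectation (collect M alg K) (\<lambda>d. \<Sum>x\<leftarrow>d. c (fst x))
     + measure_pmf.expectation (collect M alg K) (\<lambda>d. measure_pmf.expectation (alg d) c)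
     = measure_pmf.expectation (collect M alg (Suc K)) (\<lambda>d. \<Sum>x\<leftarrow>d. c (fst x))"
    unfolding expectation_collect_Suc[of c, OF c(2)]
    by (intro Bochner_Integration.integral_add[symmetric] integrable_pmf_bounded[where B = "real K * C"]
        integrable_pmf_bounded[where B = C] cost)
       (rule abs_sum_collect_le[of c, OF c(2)])
  finally show ?case .
qed

lemma trans_two_step: "trans (two_step \<Delta>1 \<Delta>2 p) = trans (two_step \<Delta>1' \<Delta>2' p)"
  by (simp add: two_step_def)

text \<open>The instances differ only in the rewards at step 2, so the cost is
  \<open>\<kappa>\<close> averaged over the state reached there.\<close>

lemma KL_le_episode_two_step:
  assumes \<kappa>: "\<And>s a. s \<noteq> S0 \<Longrightarrow> KL_le (reward (two_step \<Delta>1 \<Delta>2 p) 2 s a) (reward (two_step \<Delta>1' \<Delta>2' p) 2 s a) (\<kappa> s)"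
    and bound: "\<And>s. \<bar>\<kappa> s\<bar> \<le> k"
  shows "KL_le (episode (two_step \<Delta>1 \<Delta>2 p) \<pi>) (episode (two_step \<Delta>1' \<Delta>2' p) \<pi>)
    (measure_pmf.expectation (\<pi> 1 S0) (\<lambda>a. measure_pmf.expectation (trans (two_step \<Delta>1 \<Delta>2 p) 1 S0 a) \<kappa>))"
proof -
  let ?M = "two_step \<Delta>1 \<Delta>2 p" and ?M' = "two_step \<Delta>1' \<Delta>2' p"
  have second: "KL_le (rollout ?M \<pi> 1 2 s) (rollout ?M' \<pi> 1 2 s) (\<kappa> s)" if "s \<noteq> S0" for s
    using KL_le_bind[OF \<kappa>[OF that] KL_le_refl, where C = 0]
    by (auto simp: One_nat_def trans_two_step[of \<Delta>1 \<Delta>2 p \<Delta>1' \<Delta>2'] intro: KL_le_bind_same_const)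
  \<comment> \<open>\<open>\<kappa>\<close> is constrained only away from \<open>S0\<close>, which
    never occurs at step 2.\<close>
  have S0: "s \<noteq> S0" if "s \<in> set_pmf (trans ?M 1 S0 a)" for s a
    using that by (cases a) (auto simp: two_step_def)
  have first: "reward ?M 1 S0 a = reward ?M' 1 S0 a" for a
    by (cases a) (simp_all add: two_step_def)
  have E: "\<bar>measure_pmf.expectation P \<kappa>\<bar> \<le> k" for P
    using bound by (rule expectation_abs_le)
  have "KL_le (rollout ?M \<pi> 2 1 S0) (rollout ?M' \<pi> 2 1 S0)
     (measure_pmf.expectation (\<pi> 1 S0) (\<lambda>a. measure_pmf.expectation (trans ?M 1 S0 a) \<kappa>))"
    unfolding rollout.simps(2)[of _ _ 1 1, unfolded Suc_1] first[symmetric]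
      trans_two_step[of \<Delta>1' \<Delta>2' p \<Delta>1 \<Delta>2]
    by (rule KL_le_bind_same[where C = k], rule KL_le_bind_same_const, rule KL_le_bind_same[where C = k],
        rule KL_le_map, rule second, erule S0) (rule bound E)+
  then show ?thesis
    by (simp add: episode_def two_step_def)
qed

text \<open>The parameter moves by \<open>3 * \<Delta> / 2\<close> and \<open>q * (1 - q)\<close> is
  at least 3/16, so the chi-square bound is at most (9/4) / (3/16) = 12 times
  \<open>\<Delta>\<^sup>2\<close>.\<close>

lemma KL_le_bernoulli_reward:
  assumes "0 < \<Delta>" "\<Delta> \<le> 1 / 2"
  shows "KL_le (bernoulli_reward (1 / 2 + \<Delta>)) (bernoulli_reward (1 / 2 + - \<Delta> / 2)) (12 * \<Delta>\<^sup>2)"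
proof -
  define q where "q = 1 / 2 + - \<Delta> / 2"
  have "\<Delta>\<^sup>2 \<le> (1 / 2)\<^sup>2"
    using assms by (intro power_mono) auto
  then have "3 / 16 \<le> q * (1 - q)"
    by (simp add: q_def algebra_simps power2_eq_square)
  then have "(1 / 2 + \<Delta> - q)\<^sup>2 / (q * (1 - q)) \<le> (1 / 2 + \<Delta> - q)\<^sup>2 / (3 / 16)"
    by (intro divide_left_mono) auto
  also have "\<dots> = 12 * \<Delta>\<^sup>2"
    by (simp add: q_def field_simps power2_eq_square)
  finally have "KL_le (bernoulli_pmf (1 / 2 + \<Delta>)) (bernoulli_pmf q) (12 * \<Delta>\<^sup>2)"
    using assms by (intro KL_le_mono[OF KL_le_bernoulli]) (auto simp: q_def)
  then show ?thesis
    unfolding bernoulli_reward_def q_def by (rule KL_le_map)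
qed

text \<open>The event that the proposal is optimal for \<open>M\<close> is likely under
  \<open>M\<close> and, by disjointness, unlikely under \<open>M'\<close>. Proposing is a common
  kernel and adds no relative entropy.\<close>

lemma KL_le_computes_optimal:
  assumes KL: "KL_le (collect M alg K) (collect M' alg K) k"
    and opt: "computes_optimal M alg K propose \<delta>" "computes_optimal M' alg K propose \<delta>"
    and disj: "\<And>\<pi>. optimal M \<pi> \<Longrightarrow> \<not> optimal M' \<pi>"
    and \<delta>: "0 < \<delta>" "\<delta> \<le> 1 / 2"
  shows "(1 - 2 * \<delta>) * ln ((1 - \<delta>) / \<delta>) \<le> k"
proof (rule KL_le_event[OF _ _ _ \<delta>])
  show "KL_le (low_regret_to_pac M alg K propose) (low_regret_to_pac M' alg K propose) k"
    unfolding low_regret_to_pac_def using KL_le_bind[OF KL KL_le_refl, where C = 0] by simp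
  show "1 - \<delta> \<le> measure_pmf.prob (low_regret_to_pac M alg K propose) {\<pi>. optimal M \<pi>}"
    using opt(1) by (simp add: computes_optimal_def)
  let ?P = "low_regret_to_pac M' alg K propose"
  have "measure_pmf.prob ?P {\<pi>. optimal M \<pi>} \<le> measure_pmf.prob ?P (UNIV - {\<pi>. optimal M' \<pi>})"
    using disj by (intro measure_pmf.finite_measure_mono) auto
  also have "\<dots> = 1 - measure_pmf.prob ?P {\<pi>. optimal M' \<pi>}"
    using measure_pmf.prob_compl[of "{\<pi>. optimal M' \<pi>}" ?P] by simp
  also have "\<dots> \<le> \<delta>"
    using opt(2) by (simp add: computes_optimal_def)
  finally show "measure_pmf.prob ?P {\<pi>. optimal M \<pi>} \<le> \<delta>" .
qed

text \<open>\<open>ln ((1 - \<delta>) / \<delta>)\<close> falls short of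
  \<open>ln (1 / \<delta>)\<close> by at most \<open>m0\<close>, a fraction \<open>m0 / l0\<close>
  at worst. The factor vanishes as \<open>\<delta>0\<close> tends to 1/2, hence the dependence of
  the final constants on \<open>\<delta>0\<close>.\<close>

lemma ln_ratio_ge:
  fixes \<delta> \<delta>0 :: real
  assumes "0 < \<delta>" "\<delta> \<le> \<delta>0" "\<delta>0 < 1 / 2"
  shows "(1 - 2 * \<delta>0) * (1 - ln (1 / (1 - \<delta>0)) / ln (1 / \<delta>0)) * ln (1 / \<delta>)
    \<le> (1 - 2 * \<delta>) * ln ((1 - \<delta>) / \<delta>)"
proof -
  define l l0 m0 where "l = ln (1 / \<delta>)" and "l0 = ln (1 / \<delta>0)" and "m0 = ln (1 / (1 - \<delta>0))"
  have l0: "0 < l0" "l0 \<le> l" and m0: "0 \<le> m0" "m0 \<le> l0"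
    using assms by (auto simp: l_def l0_def m0_def intro!: ln_mono ln_ge_zero divide_left_mono)
  have "m0 * 1 \<le> m0 * (l / l0)"
    using l0 m0 by (intro mult_left_mono) auto
  then have "(1 - m0 / l0) * l \<le> l - m0"
    by (simp add: algebra_simps)
  also have "\<dots> = ln (1 - \<delta>0) + ln (1 / \<delta>)"
    using assms by (simp add: l_def m0_def ln_div)
  also have "\<dots> \<le> ln (1 - \<delta>) + ln (1 / \<delta>)"
    using assms by (intro add_mono ln_mono) auto
  also have "\<dots> = ln ((1 - \<delta>) / \<delta>)"
    using assms by (simp add: ln_div)
  finally have *: "(1 - m0 / l0) * l \<le> ln ((1 - \<delta>) / \<delta>)" .
  have "(1 - 2 * \<delta>0) * ((1 - m0 / l0) * l) \<le> (1 - 2 * \<delta>) * ln ((1 - \<delta>) / \<delta>)"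
    using assms l0 m0 by (intro mult_mono * mult_nonneg_nonneg) (auto simp: divide_le_eq)
  then show ?thesis
    by (simp add: l_def l0_def m0_def mult.assoc)
qed

text \<open>Raising the hypothesis on \<open>C1\<close> to the power \<open>1 - \<alpha>\<close>
  gives \<open>C1 * p powr (- \<alpha>) \<le> y powr (1 - \<alpha>)\<close>, which is the claim at
  the extreme value \<open>y / p\<close> of \<open>K\<close>.\<close>

lemma regret_budget_bound:
  fixes C1 p \<alpha> y :: real
  assumes "0 \<le> C1" "0 < p" "0 < \<alpha>" "\<alpha> < 1" "0 < y"
    and C1: "C1 powr (1 / (1 - \<alpha>)) * p powr (- \<alpha> / (1 - \<alpha>)) \<le> y" and K: "p * real K \<le> y"
  shows "C1 * real K powr \<alpha> \<le> y"
proof -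
  have "(C1 powr (1 / (1 - \<alpha>)) * p powr (- \<alpha> / (1 - \<alpha>))) powr (1 - \<alpha>) \<le> y powr (1 - \<alpha>)"
    using assms by (intro powr_mono2) auto
  then have "C1 * p powr (- \<alpha>) \<le> y powr (1 - \<alpha>)"
    using assms by (simp add: powr_mult powr_powr)
  then have "C1 * p powr (- \<alpha>) * y powr \<alpha> \<le> y powr (1 - \<alpha>) * y powr \<alpha>"
    by (intro mult_right_mono) auto
  also have "\<dots> = y"
    using assms by (simp flip: powr_add)
  finally have "C1 * (y / p) powr \<alpha> \<le> y"
    using assms by (simp add: powr_divide powr_minus_divide)
  moreover have "C1 * real K powr \<alpha> \<le> C1 * (y / p) powr \<alpha>"
    using assms by (intro mult_left_mono powr_mono2) (auto simp: field_simps)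
  ultimately show ?thesis by linarith
qed

context two_step_instance
begin

lemma regret_bounds: "\<bar>V0_star M - V0 M \<pi>\<bar> \<le> V0_star M"
  using V0_bounds[of \<pi>] by simp

text \<open>Serves constant costs (\<open>b = 0\<close>, first alternative) and costs that grow with
  the regret (second alternative).\<close>

lemma expectation_exploration:
  "measure_pmf.expectation (collect M alg K) (\<lambda>d. \<Sum>x\<leftarrow>d. a + b * (V0_star M - V0 M (fst x)))
    = a * real K + b * expected_regret M alg K"
proof -
  have int: "integrable (measure_pmf (collect M alg K)) (\<lambda>d. \<Sum>x\<leftarrow>d. V0_star M - V0 M (fst x))"
    by (rule integrable_pmf_bounded)
       (rule abs_sum_collect_le[of "\<lambda>\<pi>. V0_star M - V0 M \<pi>", OF regret_bounds])
  have "measure_pmf.expectation (collect M alg K) (\<lambda>d. \<Sum>x\<leftarrow>d. a + b * (V0_star M - V0 M (fst x)))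
      = measure_pmf.expectation (collect M alg K)
          (\<lambda>d. a * real K + b * (\<Sum>x\<leftarrow>d. V0_star M - V0 M (fst x)))"
    by (intro integral_cong_AE)
       (auto simp: AE_measure_pmf_iff sum_list_addf sum_list_const_mult sum_list_triv dest: length_collect)
  also have "\<dots> = a * real K + b * expected_regret M alg K"
    using int by (simp add: expected_regret_eq[OF regret_bounds])
  finally show ?thesis .
qed

end

section \<open>The two alternative instances and the information they require\<close>

context positive_gaps
begin

lemma two_step_instance_flip:
  "two_step_instance (- \<Delta>1 / 2) \<Delta>2 p" "two_step_instance \<Delta>1 (- \<Delta>2 / 2) p"
  using \<Delta>1 \<Delta>2 p pos by (auto intro!: two_step_instance.intro)

lemma not_optimal_flip:
  assumes "optimal M \<pi>"
  shows "\<not> optimal (two_step (- \<Delta>1 / 2) \<Delta>2 p) \<pi>" "\<not> optimal (two_step \<Delta>1 (- \<Delta>2 / 2) p) \<pi>"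
  using optimal_imp_sign[OF assms] pos
    two_step_instance.optimal_imp_sign(2)[OF two_step_instance_flip(1)]
    two_step_instance.optimal_imp_sign(4)[OF two_step_instance_flip(2)]
  by fastforce+

text \<open>Every episode is charged the full cost of a visit to \<open>S1\<close>; no finer count
  is required for the term in \<open>\<Delta>1\<close>.\<close>

lemma KL_le_episode_flip_1:
  "KL_le (episode M \<pi>) (episode (two_step (- \<Delta>1 / 2) \<Delta>2 p) \<pi>) (12 * \<Delta>1\<^sup>2)"
proof -
  have "KL_le (reward M 2 s a) (reward (two_step (- \<Delta>1 / 2) \<Delta>2 p) 2 s a) (12 * \<Delta>1\<^sup>2)" if "s \<noteq> S0" for s a
    using that \<Delta>1 pos KL_le_bernoulli_reward[of \<Delta>1]
    by (cases s; cases a) (auto simp: two_step_def intro: KL_le_mono[OF KL_le_refl])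
  then show ?thesis
    using KL_le_episode_two_step[of \<Delta>1 \<Delta>2 p "- \<Delta>1 / 2" \<Delta>2 "\<lambda>_. 12 * \<Delta>1\<^sup>2" "12 * \<Delta>1\<^sup>2" \<pi>] by simp
qed

text \<open>\<open>S2\<close> is reached with probability \<open>(1 - q) + q * p\<close>: the second
  summand is at most \<open>p\<close>, and the first is paid for in regret by
  \<open>suboptimality_ge\<close>.\<close>

lemma KL_le_episode_flip_2:
  "KL_le (episode M \<pi>) (episode (two_step \<Delta>1 (- \<Delta>2 / 2) p) \<pi>)
    (12 * \<Delta>2\<^sup>2 * p + 24 * \<Delta>2\<^sup>2 * (V0_star M - V0 M \<pi>))"
proof -
  define \<kappa> where "\<kappa> s = (if s = S2 then 12 * \<Delta>2\<^sup>2 else 0)" for s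
  have "KL_le (reward M 2 s a) (reward (two_step \<Delta>1 (- \<Delta>2 / 2) p) 2 s a) (\<kappa> s)" if "s \<noteq> S0" for s a
    using that \<Delta>2 pos KL_le_bernoulli_reward[of \<Delta>2]
    by (cases s; cases a) (auto simp: two_step_def \<kappa>_def intro: KL_le_mono[OF KL_le_refl])
  then have KL: "KL_le (episode M \<pi>) (episode (two_step \<Delta>1 (- \<Delta>2 / 2) p) \<pi>)
      (measure_pmf.expectation (\<pi> 1 S0) (\<lambda>a. measure_pmf.expectation (trans M 1 S0 a) \<kappa>))"
    by (rule KL_le_episode_two_step[where k = "12 * \<Delta>2\<^sup>2"]) (auto simp: \<kappa>_def)
  define q where "q = pmf (\<pi> 1 S0) A1"
  have "measure_pmf.expectation (\<pi> 1 S0) (\<lambda>a. measure_pmf.expectation (trans M 1 S0 a) \<kappa>)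
      = 12 * \<Delta>2\<^sup>2 * (1 - q * (1 - p))"
    by (simp add: expectation_action trans_S0_A1 \<kappa>_def q_def algebra_simps)
  also have "\<dots> \<le> 12 * \<Delta>2\<^sup>2 * (p + 2 * (V0_star M - V0 M \<pi>))"
  proof (rule mult_left_mono)
    have "q * p \<le> p"
      using p pmf_le_1[of "\<pi> 1 S0" A1] mult_right_mono[of q 1 p] by (simp add: q_def)
    moreover have "1 - q \<le> 2 * (V0_star M - V0 M \<pi>)"
      using suboptimality_ge[of \<pi>] by (simp add: q_def)
    ultimately show "1 - q * (1 - p) \<le> p + 2 * (V0_star M - V0 M \<pi>)"
      unfolding right_diff_distrib by linarith
  qed simp
  also have "\<dots> = 12 * \<Delta>2\<^sup>2 * p + 24 * \<Delta>2\<^sup>2 * (V0_star M - V0 M \<pi>)"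
    by (simp add: distrib_left)
  finally show ?thesis
    by (rule KL_le_mono[OF KL])
qed

lemma information_bounds:
  assumes opt: "computes_optimal_near \<Delta>1 \<Delta>2 p alg K propose \<delta>" and \<delta>: "0 < \<delta>" "\<delta> \<le> 1 / 2"
  shows "(1 - 2 * \<delta>) * ln ((1 - \<delta>) / \<delta>) \<le> 12 * \<Delta>1\<^sup>2 * real K"
    and "(1 - 2 * \<delta>) * ln ((1 - \<delta>) / \<delta>) \<le> 12 * \<Delta>2\<^sup>2 * (p * real K + 2 * expected_regret M alg K)"
proof -
  have opt: "computes_optimal M alg K propose \<delta>"
    "computes_optimal (two_step (- \<Delta>1 / 2) \<Delta>2 p) alg K propose \<delta>"
    "computes_optimal (two_step \<Delta>1 (- \<Delta>2 / 2) p) alg K propose \<delta>"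
    using \<Delta>1 \<Delta>2 pos by (auto intro!: opt[unfolded computes_optimal_near_def, rule_format])
  have cost: "\<bar>12 * \<Delta>2\<^sup>2 * p + 24 * \<Delta>2\<^sup>2 * (V0_star M - V0 M \<pi>)\<bar> \<le> 12 * \<Delta>2\<^sup>2 * p + 24 * \<Delta>2\<^sup>2 * V0_star M" for \<pi>
    using V0_bounds[of \<pi>] p by (subst abs_of_nonneg) (auto intro!: mult_left_mono)
  have "KL_le (collect M alg K) (collect (two_step (- \<Delta>1 / 2) \<Delta>2 p) alg K)
      (measure_pmf.expectation (collect M alg K) (\<lambda>d. \<Sum>x\<leftarrow>d. 12 * \<Delta>1\<^sup>2))"
    using KL_le_collect[of M _ "\<lambda>_. 12 * \<Delta>1\<^sup>2" "12 * \<Delta>1\<^sup>2", OF KL_le_episode_flip_1] by simp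
  then show "(1 - 2 * \<delta>) * ln ((1 - \<delta>) / \<delta>) \<le> 12 * \<Delta>1\<^sup>2 * real K"
    using KL_le_computes_optimal[OF _ opt(1,2) not_optimal_flip(1) \<delta>] expectation_exploration[of alg K "12 * \<Delta>1\<^sup>2" 0]
    by simp
  have "KL_le (collect M alg K) (collect (two_step \<Delta>1 (- \<Delta>2 / 2) p) alg K)
      (12 * \<Delta>2\<^sup>2 * p * real K + 24 * \<Delta>2\<^sup>2 * expected_regret M alg K)"
    unfolding expectation_exploration[symmetric]
    by (rule KL_le_collect[of M _ "\<lambda>\<pi>. 12 * \<Delta>2\<^sup>2 * p + 24 * \<Delta>2\<^sup>2 * (V0_star M - V0 M \<pi>)"])
       (rule KL_le_episode_flip_2 cost)+
  then have "(1 - 2 * \<delta>) * ln ((1 - \<delta>) / \<delta>) \<le> 12 * \<Delta>2\<^sup>2 * p * real K + 24 * \<Delta>2\<^sup>2 * expected_regret M alg K"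
    using opt(1,3) not_optimal_flip(2) \<delta> by (rule KL_le_computes_optimal)
  then show "(1 - 2 * \<delta>) * ln ((1 - \<delta>) / \<delta>) \<le> 12 * \<Delta>2\<^sup>2 * (p * real K + 2 * expected_regret M alg K)"
    by (simp add: algebra_simps)
qed

end

text \<open>Since 96 = 12 * 8, dividing the information bounds by 12 leaves a factor 8, enough slack
  to absorb the regret terms below.\<close>

lemma low_regret_episodes_lower_bound:
  fixes \<delta>0 :: real
  assumes \<delta>0: "0 < \<delta>0" "\<delta>0 < 1 / 2"
  defines "x \<equiv> (1 - 2 * \<delta>0) * (1 - ln (1 / (1 - \<delta>0)) / ln (1 / \<delta>0)) / 96"
  shows "0 < x"
    and "\<lbrakk>0 < \<Delta>1; \<Delta>1 \<le> 1 / 2; 0 < \<Delta>2; \<Delta>2 \<le> 1 / 2; 0 < p; p < 1 / 2; 0 < \<delta>; \<delta> \<le> \<delta>0;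
      0 \<le> C1; 0 < \<alpha>; \<alpha> < 1; low_regret (two_step \<Delta>1 \<Delta>2 p) alg K C1 C2 \<alpha>;
      computes_optimal_near \<Delta>1 \<Delta>2 p alg K propose \<delta>;
      1 / x * max C2 (C1 powr (1 / (1 - \<alpha>)) * p powr (- \<alpha> / (1 - \<alpha>))) \<le> ln (1 / \<delta>) / \<Delta>2\<^sup>2\<rbrakk>
      \<Longrightarrow> x / 2 * (ln (1 / \<delta>) / \<Delta>1\<^sup>2 + ln (1 / \<delta>) / (p * \<Delta>2\<^sup>2)) \<le> real K"
proof -
  have "ln (1 / (1 - \<delta>0)) < ln (1 / \<delta>0)"
    using \<delta>0 by (subst ln_less_cancel_iff) (auto intro!: divide_strict_left_mono)
  then have "ln (1 / (1 - \<delta>0)) / ln (1 / \<delta>0) < 1"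
    using \<delta>0 by (subst divide_less_eq_1_pos) auto
  then show x: "0 < x"
    using \<delta>0 by (simp add: x_def)
  assume \<Delta>: "0 < \<Delta>1" "\<Delta>1 \<le> 1 / 2" "0 < \<Delta>2" "\<Delta>2 \<le> 1 / 2" and p: "0 < p" "p < 1 / 2"
    and \<delta>: "0 < \<delta>" "\<delta> \<le> \<delta>0" and C: "0 \<le> C1" "0 < \<alpha>" "\<alpha> < 1"
    and regret: "low_regret (two_step \<Delta>1 \<Delta>2 p) alg K C1 C2 \<alpha>"
    and opt: "computes_optimal_near \<Delta>1 \<Delta>2 p alg K propose \<delta>"
    and budget: "1 / x * max C2 (C1 powr (1 / (1 - \<alpha>)) * p powr (- \<alpha> / (1 - \<alpha>))) \<le> ln (1 / \<delta>) / \<Delta>2\<^sup>2"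
  interpret positive_gaps \<Delta>1 \<Delta>2 p
    using \<Delta> p by unfold_locales auto
  define l where "l = ln (1 / \<delta>)"
  have l: "0 < l" using \<delta> \<delta>0 by (simp add: l_def)
  have information: "96 * x * l \<le> (1 - 2 * \<delta>) * ln ((1 - \<delta>) / \<delta>)"
    using ln_ratio_ge[OF \<delta> \<delta>0(2)] by (simp add: x_def l_def)
  have "\<delta> \<le> 1 / 2" using \<delta> \<delta>0 by simp
  note bounds = information_bounds[OF opt \<delta>(1) this]
  have "96 * x * l \<le> 12 * \<Delta>1\<^sup>2 * real K"
    using information bounds(1) by linarith
  then have K1: "8 * x * (l / \<Delta>1\<^sup>2) \<le> real K"
    using \<Delta> by (simp add: field_simps)
  define y where "y = x * (l / \<Delta>2\<^sup>2)"
  have y: "0 < y" using x l \<Delta> by (simp add: y_def)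
  have "max C2 (C1 powr (1 / (1 - \<alpha>)) * p powr (- \<alpha> / (1 - \<alpha>))) \<le> y"
    using budget x unfolding l_def[symmetric] y_def by (simp add: field_simps)
  then have C2: "C2 \<le> y" and C1: "C1 powr (1 / (1 - \<alpha>)) * p powr (- \<alpha> / (1 - \<alpha>)) \<le> y"
    by auto
  have "96 * x * l \<le> 12 * \<Delta>2\<^sup>2 * (p * real K + 2 * expected_regret M alg K)"
    using information bounds(2) by linarith
  then have "8 * y \<le> p * real K + 2 * expected_regret M alg K"
    using \<Delta> by (simp add: y_def field_simps)
  also have "\<dots> \<le> p * real K + 2 * (C1 * real K powr \<alpha> + C2)"
    using regret by (simp add: low_regret_def)
  finally have *: "8 * y \<le> p * real K + 2 * (C1 * real K powr \<alpha> + C2)" .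
  have "y \<le> p * real K"
  proof (rule ccontr)
    \<comment> \<open>Then \<open>p * real K\<close>, \<open>C1 * real K powr \<alpha>\<close> and
      \<open>C2\<close> are all at most \<open>y\<close>, so the right-hand side of \<open>*\<close>
      is at most \<open>5 * y\<close>, short of \<open>8 * y\<close>.\<close>
    assume "\<not> y \<le> p * real K"
    then have "p * real K \<le> y" by simp
    moreover from this have "C1 * real K powr \<alpha> \<le> y"
      using C p y C1 by (intro regret_budget_bound)
    ultimately show False
      using * C2 y unfolding distrib_left by linarith
  qed
  then have K2: "x * (l / (p * \<Delta>2\<^sup>2)) \<le> real K"
    using p \<Delta> by (simp add: y_def field_simps)
  have "0 \<le> x * (l / \<Delta>1\<^sup>2)"
    using x l by simp
  \<comment> \<open>Adding the two bounds costs the factor 2 in \<open>x / 2\<close>.\<close>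
  with K1 K2 have "x * (l / \<Delta>1\<^sup>2) + x * (l / (p * \<Delta>2\<^sup>2)) \<le> 2 * real K"
    by linarith
  then show "x / 2 * (ln (1 / \<delta>) / \<Delta>1\<^sup>2 + ln (1 / \<delta>) / (p * \<Delta>2\<^sup>2)) \<le> real K"
    unfolding l_def[symmetric] distrib_left[symmetric] by simp
qed

section \<open>MOCA\<close>

text \<open>Both terms of the guarantee are bounded by complexity times \<open>l\<close> times a
  constant multiple of \<open>X ^ b\<close>. The second lacks the factor \<open>l\<close>; as
  \<open>\<delta> \<le> \<delta>0\<close> gives \<open>l0 \<le> l\<close>, the ratio
  \<open>l / l0\<close> can be inserted.\<close>

lemma moca_terminates:
  fixes moca :: "nat \<Rightarrow> real \<Rightarrow> real \<Rightarrow> (state, action) pac_algorithm"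
  assumes moca: "is_moca moca" and \<delta>0: "0 < \<delta>0" "\<delta>0 < 1"
  shows "\<exists>B b. B > 0 \<and>
    (\<forall>\<Delta>1 \<Delta>2 p \<epsilon> \<delta>.
       0 < \<Delta>1 \<and> \<Delta>1 \<le> 1 / 2 \<and> 0 < \<Delta>2 \<and> \<Delta>2 \<le> 1 / 2 \<and> 0 < p \<and> p < 1 / 2 \<and>
       0 < \<delta> \<and> \<delta> \<le> \<delta>0 \<and> 0 < \<epsilon> \<and> \<epsilon> < eps_star (two_step \<Delta>1 \<Delta>2 p) \<longrightarrow>
       (\<exists>K. ennreal (real K) \<le> complexity (two_step \<Delta>1 \<Delta>2 p) * ennreal (ln (1 / \<delta>))
              * ennreal (B * ln (1 / (eps_star (two_step \<Delta>1 \<Delta>2 p) * \<delta>)) ^ b) \<and>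
            returns_within (two_step \<Delta>1 \<Delta>2 p) (moca 2 \<epsilon> \<delta>) K
              (optimal (two_step \<Delta>1 \<Delta>2 p)) \<ge> 1 - \<delta>))"
proof -
  obtain a b where guarantee: "\<And>M \<epsilon> \<delta>. valid_mdp M \<and> unique_optimal_actions M \<and> 0 < \<epsilon> \<and> \<epsilon> < eps_star M \<and> 0 < \<delta> \<and> \<delta> < 1 \<Longrightarrow>
      \<exists>K. ennreal (real K) \<le> complexity M * ennreal ((real (horizon M))\<^sup>2
             * (a * (1 + ln (real CARD(state) * real CARD(action) * real (horizon M) / eps_star M)) ^ b) * ln (1 / \<delta>))
           + ennreal (a * (1 + real CARD(state) + real CARD(action) + real (horizon M)
               + \<bar>ln (1 / eps_star M)\<bar> + ln (1 / \<delta>)) ^ b / eps_star M) \<and>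
         returns_within M (moca (horizon M) \<epsilon> \<delta>) K (optimal M) \<ge> 1 - \<delta>"
    using moca unfolding is_moca_def Let_def by blast
  have card: "CARD(state) = 3" "CARD(action) = 2"
    by (simp_all add: UNIV_state UNIV_action)
  \<comment> \<open>The constant \<open>a\<close> of the guarantee may be negative or zero.\<close>
  define a' where "a' = max a 1"
  have a': "a \<le> a'" "1 \<le> a'" by (auto simp: a'_def)
  define l0 where "l0 = ln (1 / \<delta>0)"
  have l0: "0 < l0" using \<delta>0 by (simp add: l0_def)
  \<comment> \<open>First summand: 4 is the squared horizon and
    \<open>1 + ln (12 / e) \<le> 6 * X\<close>, with 12 = 3 * 2 * 2. Second: \<open>1 / e\<close> is
    at most 3 times the complexity and \<open>8 + \<bar>ln (1 / e)\<bar> + l \<le> 9 * X\<close>,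
    with 8 = 1 + 3 + 2 + 2.\<close>
  define B where "B = 4 * a' * 6 ^ b + 3 * a' * 9 ^ b / l0"
  have "0 < B" using a' l0 by (auto simp: B_def intro!: add_pos_pos)
  moreover have "\<exists>K. ennreal (real K) \<le> complexity (two_step \<Delta>1 \<Delta>2 p) * ennreal (ln (1 / \<delta>))
              * ennreal (B * ln (1 / (eps_star (two_step \<Delta>1 \<Delta>2 p) * \<delta>)) ^ b) \<and>
            returns_within (two_step \<Delta>1 \<Delta>2 p) (moca 2 \<epsilon> \<delta>) K
              (optimal (two_step \<Delta>1 \<Delta>2 p)) \<ge> 1 - \<delta>"
    if \<Delta>: "0 < \<Delta>1" "\<Delta>1 \<le> 1 / 2" "0 < \<Delta>2" "\<Delta>2 \<le> 1 / 2" and p: "0 < p" "p < 1 / 2"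
      and \<delta>: "0 < \<delta>" "\<delta> \<le> \<delta>0" and \<epsilon>: "0 < \<epsilon>" "\<epsilon> < eps_star (two_step \<Delta>1 \<Delta>2 p)" for \<Delta>1 \<Delta>2 p \<epsilon> \<delta>
  proof -
    interpret positive_gaps \<Delta>1 \<Delta>2 p
      using \<Delta> p by unfold_locales auto
    define e l X where "e = eps_star M" and "l = ln (1 / \<delta>)" and "X = ln (1 / (e * \<delta>))"
    have e: "0 < e" "e \<le> 1 / 6" using \<epsilon> eps_star_bounds(2) by (auto simp: e_def)
    have l: "l0 \<le> l" using \<delta> \<delta>0 by (auto simp: l_def l0_def intro!: ln_mono divide_left_mono)
    have X: "X = ln (1 / e) + l"
      using e \<delta> by (simp add: X_def l_def ln_div ln_mult)
    \<comment> \<open>Since \<open>e \<le> 1 / 6\<close>, this gives \<open>1 \<le> X\<close>, which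
      lets \<open>X\<close> absorb additive constants.\<close>
    have "exp 1 \<le> (6 :: real)" using exp_le by linarith
    then have "1 \<le> ln (6 :: real)" by (subst ln_ge_iff) auto
    also have "\<dots> \<le> ln (1 / e)" using e by (intro ln_mono) (auto simp: field_simps)
    finally have ln_e: "1 \<le> ln (1 / e)" .
    then have X1: "1 \<le> X" using X l l0 by linarith
    have "ln (12 / e) \<le> ln 12 + ln (1 / e)"
      using e by (simp add: ln_div)
    moreover have "ln (12 :: real) \<le> 4"
    proof -
      have "ln (12 :: real) \<le> ln (2 ^ 4)" by (intro ln_mono) auto
      also have "\<dots> = 4 * ln 2" by (subst ln_realpow) auto
      also have "\<dots> \<le> 4" using ln_le_minus_one[of "2 :: real"] by simp
      finally show ?thesis .
    qed
    ultimately have "1 + ln (12 / e) \<le> 6 * X" using X X1 l l0 by linarith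
    moreover have "0 \<le> 1 + ln (12 / e)" using e by (auto intro!: add_nonneg_nonneg ln_ge_zero simp: field_simps)
    ultimately have "(1 + ln (12 / e)) ^ b \<le> (6 * X) ^ b" by (rule power_mono)
    then have "a * (1 + ln (12 / e)) ^ b \<le> a' * (6 * X) ^ b"
      using a' \<open>0 \<le> 1 + ln (12 / e)\<close> by (intro mult_mono) auto
    then have "4 * (a * (1 + ln (12 / e)) ^ b) * l \<le> 4 * (a' * (6 * X) ^ b) * l"
      using l l0 by (intro mult_right_mono) auto
    also have "\<dots> = l * (4 * a' * 6 ^ b * X ^ b)"
      by (simp add: power_mult_distrib)
    finally have main: "complexity M * ennreal (4 * (a * (1 + ln (12 / e)) ^ b) * l)
        \<le> complexity M * ennreal (l * (4 * a' * 6 ^ b * X ^ b))"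
      by (intro mult_left_mono ennreal_leI) auto
    have "(8 + \<bar>ln (1 / e)\<bar> + l) ^ b \<le> (9 * X) ^ b"
      using X X1 l l0 ln_e by (intro power_mono) auto
    then have C: "a * (8 + \<bar>ln (1 / e)\<bar> + l) ^ b \<le> a' * (9 * X) ^ b"
      using a' l l0 by (intro mult_mono) auto
    have complexity: "ennreal (1 / e) \<le> complexity M * ennreal 3"
    proof -
      define m where "m = min \<Delta>1 \<Delta>2"
      have m: "0 < m" "m \<le> 1 / 2" "m / 6 \<le> e"
        using \<Delta> eps_star_bounds(1) by (auto simp: m_def e_def)
      have "1 / e \<le> 1 / (m / 6)"
        using m e by (intro divide_left_mono) auto
      \<comment> \<open>\<open>6 / m \<le> 3 / m\<^sup>2\<close> is exactly
        \<open>m \<le> 1 / 2\<close>.\<close>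
      also have "\<dots> \<le> 1 / m\<^sup>2 * 3"
        using m by (simp add: field_simps power2_eq_square)
      finally have "ennreal (1 / e) \<le> ennreal (1 / m\<^sup>2) * ennreal 3"
        by (subst ennreal_mult[symmetric]) (auto intro: ennreal_leI)
      also have "\<dots> \<le> complexity M * ennreal 3"
        unfolding m_def by (intro mult_right_mono complexity_ge) auto
      finally show ?thesis .
    qed
    have "a * (8 + \<bar>ln (1 / e)\<bar> + l) ^ b / e \<le> 1 / e * (a' * (9 * X) ^ b)"
      using C e by (simp add: field_simps)
    also have "\<dots> \<le> 1 / e * (l * (a' * 9 ^ b / l0 * X ^ b))"
    proof -
      have "1 * (a' * (9 * X) ^ b) \<le> l / l0 * (a' * (9 * X) ^ b)"
        using l l0 a' X1 by (intro mult_right_mono) auto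
      then show ?thesis
        using e by (intro mult_left_mono) (auto simp: power_mult_distrib mult_ac)
    qed
    finally have "ennreal (a * (8 + \<bar>ln (1 / e)\<bar> + l) ^ b / e)
        \<le> ennreal (1 / e) * ennreal (l * (a' * 9 ^ b / l0 * X ^ b))"
      using e l l0 a' X1 by (subst ennreal_mult[symmetric]) (auto intro: ennreal_leI)
    also have "\<dots> \<le> complexity M * ennreal 3 * ennreal (l * (a' * 9 ^ b / l0 * X ^ b))"
      by (intro mult_right_mono complexity) auto
    also have "\<dots> = complexity M * ennreal (l * (3 * a' * 9 ^ b / l0 * X ^ b))"
    proof -
      have "ennreal 3 * ennreal (l * (a' * 9 ^ b / l0 * X ^ b)) = ennreal (3 * (l * (a' * 9 ^ b / l0 * X ^ b)))"
        using l l0 a' X1 by (intro ennreal_mult[symmetric]) auto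
      also have "3 * (l * (a' * 9 ^ b / l0 * X ^ b)) = l * (3 * a' * 9 ^ b / l0 * X ^ b)"
        by simp
      finally show ?thesis
        by (simp only: mult.assoc)
    qed
    finally have rest: "ennreal (a * (8 + \<bar>ln (1 / e)\<bar> + l) ^ b / e)
        \<le> complexity M * ennreal (l * (3 * a' * 9 ^ b / l0 * X ^ b))" .
    have sum: "complexity M * ennreal (l * (4 * a' * 6 ^ b * X ^ b))
        + complexity M * ennreal (l * (3 * a' * 9 ^ b / l0 * X ^ b))
        = complexity M * ennreal l * ennreal (B * X ^ b)"
    proof -
      have "ennreal (l * (4 * a' * 6 ^ b * X ^ b)) + ennreal (l * (3 * a' * 9 ^ b / l0 * X ^ b))
          = ennreal (l * (4 * a' * 6 ^ b * X ^ b) + l * (3 * a' * 9 ^ b / l0 * X ^ b))"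
        using l l0 a' X1 by (intro ennreal_plus[symmetric]) auto
      also have "\<dots> = ennreal (l * (B * X ^ b))"
        by (simp add: B_def algebra_simps)
      also have "\<dots> = ennreal l * ennreal (B * X ^ b)"
        using l l0 \<open>0 < B\<close> X1 by (intro ennreal_mult) auto
      finally show ?thesis
        by (simp add: distrib_left[symmetric] mult.assoc)
    qed
    obtain K where K: "ennreal (real K) \<le> complexity M * ennreal (4 * (a * (1 + ln (12 / e)) ^ b) * l)
          + ennreal (a * (8 + \<bar>ln (1 / e)\<bar> + l) ^ b / e)"
      and returns: "returns_within M (moca 2 \<epsilon> \<delta>) K (optimal M) \<ge> 1 - \<delta>"
      using guarantee[of M \<epsilon> \<delta>] valid unique_optimal_actions \<epsilon> \<delta> \<delta>0
      by (auto simp: card e_def l_def)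
    have "ennreal (real K) \<le> complexity M * ennreal l * ennreal (B * X ^ b)"
      using K add_mono[OF main rest] unfolding sum by (rule order_trans)
    with returns show ?thesis
      unfolding l_def X_def e_def by blast
  qed
  ultimately show ?thesis by blast
qed

theorem proposition15:
  shows
    "(\<forall>\<delta>0::real. 0 < \<delta>0 \<and> \<delta>0 < 1 / 2 \<longrightarrow>
       (\<exists>c0::real. \<exists>c::real. c0 > 0 \<and> c > 0 \<and>
         (\<forall>\<Delta>1 \<Delta>2 p \<delta> C1 C2 \<alpha> K alg propose.
            0 < \<Delta>1 \<and> \<Delta>1 \<le> 1 / 2 \<and> 0 < \<Delta>2 \<and> \<Delta>2 \<le> 1 / 2 \<and> 0 < p \<and> p < 1 / 2 \<and>
            0 < \<delta> \<and> \<delta> \<le> \<delta>0 \<and>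
            0 \<le> C1 \<and> 0 \<le> C2 \<and> 0 < \<alpha> \<and> \<alpha> < 1 \<and>
            low_regret (two_step \<Delta>1 \<Delta>2 p) alg K C1 C2 \<alpha> \<and>
            computes_optimal_near \<Delta>1 \<Delta>2 p alg K propose \<delta> \<and>
            ln (1 / \<delta>) / \<Delta>2\<^sup>2
              \<ge> c * max C2 (C1 powr (1 / (1 - \<alpha>)) * p powr (- \<alpha> / (1 - \<alpha>))) \<longrightarrow>
            real K \<ge> c0 * (ln (1 / \<delta>) / \<Delta>1\<^sup>2 + ln (1 / \<delta>) / (p * \<Delta>2\<^sup>2))))) \<and>
     (\<exists>B::real. B > 0 \<and>
       (\<forall>\<Delta>1 \<Delta>2 p.
          0 < \<Delta>1 \<and> \<Delta>1 \<le> 1 / 2 \<and> 0 < \<Delta>2 \<and> \<Delta>2 \<le> 1 / 2 \<and> 0 < p \<and> p < 1 / 2 \<longrightarrow>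
          complexity (two_step \<Delta>1 \<Delta>2 p) \<le> ennreal (B * (1 / \<Delta>1\<^sup>2 + 1 / \<Delta>2\<^sup>2)))) \<and>
     (\<forall>moca. is_moca moca \<longrightarrow>
       (\<forall>\<delta>0::real. 0 < \<delta>0 \<and> \<delta>0 < 1 \<longrightarrow>
         (\<exists>B::real. \<exists>b::nat. B > 0 \<and>
           (\<forall>\<Delta>1 \<Delta>2 p \<epsilon> \<delta>.
              0 < \<Delta>1 \<and> \<Delta>1 \<le> 1 / 2 \<and> 0 < \<Delta>2 \<and> \<Delta>2 \<le> 1 / 2 \<and> 0 < p \<and> p < 1 / 2 \<and>
              0 < \<delta> \<and> \<delta> \<le> \<delta>0 \<and>
              0 < \<epsilon> \<and> \<epsilon> < eps_star (two_step \<Delta>1 \<Delta>2 p) \<longrightarrow>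
              (\<exists>K. ennreal (real K)
                     \<le> complexity (two_step \<Delta>1 \<Delta>2 p) * ennreal (ln (1 / \<delta>))
                       * ennreal (B * ln (1 / (eps_star (two_step \<Delta>1 \<Delta>2 p) * \<delta>)) ^ b) \<and>
                   returns_within (two_step \<Delta>1 \<Delta>2 p) (moca 2 \<epsilon> \<delta>) K
                     (optimal (two_step \<Delta>1 \<Delta>2 p)) \<ge> 1 - \<delta>)))))"
proof (intro conjI allI impI)
  fix \<delta>0 :: real assume \<delta>0: "0 < \<delta>0 \<and> \<delta>0 < 1 / 2"
  \<comment> \<open>The witnesses are \<open>x / 2\<close> for \<open>c0\<close> and
    \<open>1 / x\<close> for \<open>c\<close>.\<close>
  define x where "x = (1 - 2 * \<delta>0) * (1 - ln (1 / (1 - \<delta>0)) / ln (1 / \<delta>0)) / 96"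
  note bound = low_regret_episodes_lower_bound[of \<delta>0, folded x_def]
  show "\<exists>c0 c::real. c0 > 0 \<and> c > 0 \<and>
         (\<forall>\<Delta>1 \<Delta>2 p \<delta> C1 C2 \<alpha> K alg propose.
            0 < \<Delta>1 \<and> \<Delta>1 \<le> 1 / 2 \<and> 0 < \<Delta>2 \<and> \<Delta>2 \<le> 1 / 2 \<and> 0 < p \<and> p < 1 / 2 \<and>
            0 < \<delta> \<and> \<delta> \<le> \<delta>0 \<and>
            0 \<le> C1 \<and> 0 \<le> C2 \<and> 0 < \<alpha> \<and> \<alpha> < 1 \<and>
            low_regret (two_step \<Delta>1 \<Delta>2 p) alg K C1 C2 \<alpha> \<and>
            computes_optimal_near \<Delta>1 \<Delta>2 p alg K propose \<delta> \<and>
            ln (1 / \<delta>) / \<Delta>2\<^sup>2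
              \<ge> c * max C2 (C1 powr (1 / (1 - \<alpha>)) * p powr (- \<alpha> / (1 - \<alpha>))) \<longrightarrow>
            real K \<ge> c0 * (ln (1 / \<delta>) / \<Delta>1\<^sup>2 + ln (1 / \<delta>) / (p * \<Delta>2\<^sup>2)))"
  proof (rule exI[of _ "x / 2"], rule exI[of _ "1 / x"], intro conjI allI impI; (elim conjE)?)
    show "0 < x / 2" "0 < 1 / x" using bound(1) \<delta>0 by auto
  qed (rule bound(2), use \<delta>0 in auto)
next
  have "complexity (two_step \<Delta>1 \<Delta>2 p) \<le> ennreal (5 * (1 / \<Delta>1\<^sup>2 + 1 / \<Delta>2\<^sup>2))"
    if "0 < \<Delta>1" "\<Delta>1 \<le> 1 / 2" "0 < \<Delta>2" "\<Delta>2 \<le> 1 / 2" "0 < p" "p < 1 / 2" for \<Delta>1 \<Delta>2 p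
  proof -
    interpret positive_gaps \<Delta>1 \<Delta>2 p
      using that by unfold_locales auto
    show ?thesis by (rule complexity_le)
  qed
  then show "\<exists>B::real. B > 0 \<and>
       (\<forall>\<Delta>1 \<Delta>2 p.
          0 < \<Delta>1 \<and> \<Delta>1 \<le> 1 / 2 \<and> 0 < \<Delta>2 \<and> \<Delta>2 \<le> 1 / 2 \<and> 0 < p \<and> p < 1 / 2 \<longrightarrow>
          complexity (two_step \<Delta>1 \<Delta>2 p) \<le> ennreal (B * (1 / \<Delta>1\<^sup>2 + 1 / \<Delta>2\<^sup>2)))"
    by (intro exI[of _ 5]) simp
qed (rule moca_terminates, auto)

end
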